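(* For every elementary wqo $E$ given by an expression in normal form, $\mathbf{h}(\mathcal{P}_f(E))=\underline{\mathbf{o}}(E)$.
   Context: A wqo is a quasi-order in which every infinite sequence has $i<j$ with $x_i\le x_j$. $\mathbf{o}(A),\mathbf{h}(A),\mathbf{w}(A)$ are the ranks of the roots of the well-founded trees of finite bad sequences, finite strictly decreasing sequences, and finite sequences of pairwise incomparable elements of $A$ (root: empty sequence, children: one-element extensions; rank $r(s)=\sup\{r(t)+1: t\text{ child of } s\}$). Multiplicatively indecomposable ordinals $\ge\omega$ are those of the form $\omega^{\omega^\gamma}$; an ordinal $\alpha$ is viewed as the wqo $(\alpha,\le)$. Constructions: $E_1\sqcup E_2$ disjoint union ordered by $\le_{E_1}\cup\le_{E_2}$; $E_1\times E_2$ Cartesian product with componentwise order; $E^{<\omega}$ finite words with subword embedding; $\mathsf{M}^\diamond(E)$ finite multisets with multiset embedding, and $\mathsf{M}^\diamond_n(E)$ its restriction to multisets of exactly $n$ elements; $\mathcal{P}_f(E)$ finite subsets with Hoare embedding ($S\le_H S'$ iff $\forall a\in S\,\exists b\in S'\,a\le b$); $E^{\times n}$ the $n$-fold Cartesian power. Elementary wqos are given by expressions of the grammar $E::=\alpha\ (\alpha\ge\omega^\omega\text{ multiplicatively indecomposable})\mid E_1\sqcup E_2\mid E_1\times E_2\mid E^{<\omega}\mid\mathsf{M}^\diamond(E)\mid\mathcal{P}_f(E)$; such an expression is in normal form if no subexpression can be rewritten by the rules $\mathcal{P}_f(\alpha)\to\alpha$; $E\times(E_1\sqcup E_2)\to(E\times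 E_1)\sqcup(E\times E_2)$; $(E_1\sqcup E_2)\times E\to(E_1\times E)\sqcup(E_2\times E)$; $\mathsf{M}^\diamond(E_1\sqcup E_2)\to\mathsf{M}^\diamond(E_1)\times\mathsf{M}^\diamond(E_2)$; $\mathcal{P}_f(E_1\sqcup E_2)\to\mathcal{P}_f(E_1)\times\mathcal{P}_f(E_2)$. Two wqos are wpo-isomorphic ($\cong_{wpo}$) if their quotients by $x\equiv y\iff x\le y\le x$ are isomorphic. Approximation $E'<_{\mathrm{approx}}E$ (by recursion on the expression $E$): if $E=\alpha$, $E'\cong_{wpo}\alpha'$ for some $\alpha'<\alpha$; if $E=E_1\sqcup E_2$ (resp. $E_1\times E_2$), $E'\cong_{wpo}E_1'\sqcup E_2'$ (resp. $E_1'\times E_2'$) with $E_i'<_{\mathrm{approx}}E_i$; if $E=E_1^{<\omega}$, $E'\cong_{wpo}(E_1')^{\times n}$ with $E_1'<_{\mathrm{approx}}E_1$, $n<\omega$; if $E=\mathsf{M}^\diamond(E_1)$, $E'\cong_{wpo}\mathsf{M}^\diamond_n(E_1')$ with $E_1'<_{\mathrm{approx}}E_1$, $n<\omega$; if $E=\mathcal{P}_f(E_1)$, $E'\cong_{wpo}\mathcal{P}_f(E_1')$ with $E_1'<_{\mathrm{approx}}E_1$. For $\mathbf{f}\in\{\mathbf{o},\mathbf{h},\mathbf{w}\}$, the weakened invariant is $\underline{\mathbf{f}}(E)=\sup\{\mathbf{f}(E')+1: E'<_{\mathrm{approx}}E\}$. *)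

theory Defs
  imports Main "HOL-Library.Multiset" "HOL-Library.FSet" "HOL-Library.Sublist"
begin

definition oprod_rel :: "'a rel \<Rightarrow> 'b rel \<Rightarrow> ('a \<times> 'b) rel" where
  "oprod_rel r s = {((x,y),(x',y')). x \<in> Field r \<and> x' \<in> Field r \<and> y \<in> Field s \<and> y' \<in> Field s \<and>
      (((y,y') \<in> s \<and> y \<noteq> y') \<or> (y = y' \<and> (x,x') \<in> r))}"

definition seg :: "'a rel \<Rightarrow> 'a \<Rightarrow> 'a rel" where
  "seg r a = Restr r (underS r a)"

definition mult_indec :: "'a rel \<Rightarrow> bool" where
  "mult_indec r \<longleftrightarrow> Well_order r \<and>
     (\<forall>a\<in>Field r. \<forall>b\<in>Field r. (oprod_rel (seg r a) (seg r b), r) \<in> ordLess)"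

text \<open>Multiplicatively indecomposable and > omega, i.e. of the form omega^(omega^gamma) >= omega^omega.\<close>
definition admissible_ord :: "'a rel \<Rightarrow> bool" where
  "admissible_ord r \<longleftrightarrow> mult_indec r \<and> (natLeq, r) \<in> ordLess"

type_synonym 'v qo = "'v set \<times> ('v \<Rightarrow> 'v \<Rightarrow> bool)"

definition quasi_order :: "'v qo \<Rightarrow> bool" where
  "quasi_order Q \<longleftrightarrow> (\<forall>x\<in>fst Q. snd Q x x) \<and>
     (\<forall>x\<in>fst Q. \<forall>y\<in>fst Q. \<forall>z\<in>fst Q. snd Q x y \<longrightarrow> snd Q y z \<longrightarrow> snd Q x z)"

definition wqo :: "'v qo \<Rightarrow> bool" where
  "wqo Q \<longleftrightarrow> quasi_order Q \<and>
     (\<forall>f::nat \<Rightarrow> 'v. (\<forall>i. f i \<in> fst Q) \<longrightarrow> (\<exists>i j. i < j \<and> snd Q (f i) (f j)))"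

definition qclass :: "'v qo \<Rightarrow> 'v \<Rightarrow> 'v set" where
  "qclass Q x = {y \<in> fst Q. snd Q x y \<and> snd Q y x}"

definition quot :: "'v qo \<Rightarrow> 'v set set" where
  "quot Q = qclass Q ` fst Q"

definition qle :: "'v qo \<Rightarrow> 'v set \<Rightarrow> 'v set \<Rightarrow> bool" where
  "qle Q C D \<longleftrightarrow> (\<exists>x\<in>C. \<exists>y\<in>D. snd Q x y)"

definition wpo_iso :: "'v qo \<Rightarrow> 'w qo \<Rightarrow> bool" where
  "wpo_iso Q R \<longleftrightarrow> quasi_order Q \<and> quasi_order R \<and>
     (\<exists>g. bij_betw g (quot Q) (quot R) \<and>
        (\<forall>C\<in>quot Q. \<forall>D\<in>quot Q. qle Q C D \<longleftrightarrow> qle R (g C) (g D)))"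

datatype 'a val = Atm 'a | InL "'a val" | InR "'a val" | Pr "'a val" "'a val"
  | Wd "'a val list" | MS "'a val multiset" | FS "'a val fset"

definition qord :: "'a rel \<Rightarrow> 'a val qo" where
  "qord r = (Atm ` Field r, \<lambda>x y. case (x, y) of (Atm a, Atm b) \<Rightarrow> (a, b) \<in> r | _ \<Rightarrow> False)"

definition qsum :: "'a val qo \<Rightarrow> 'a val qo \<Rightarrow> 'a val qo" where
  "qsum Q R = (InL ` fst Q \<union> InR ` fst R,
     \<lambda>x y. case (x, y) of (InL a, InL b) \<Rightarrow> snd Q a b | (InR a, InR b) \<Rightarrow> snd R a b | _ \<Rightarrow> False)"

definition qprod :: "'a val qo \<Rightarrow> 'a val qo \<Rightarrow> 'a val qo" where
  "qprod Q R = ({Pr a b | a b. a \<in> fst Q \<and> b \<in> fst R},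
     \<lambda>x y. case (x, y) of (Pr a b, Pr a' b') \<Rightarrow> snd Q a a' \<and> snd R b b' | _ \<Rightarrow> False)"

definition qstar :: "'a val qo \<Rightarrow> 'a val qo" where
  "qstar Q = ({Wd xs | xs. set xs \<subseteq> fst Q},
     \<lambda>x y. case (x, y) of (Wd xs, Wd ys) \<Rightarrow> list_emb (snd Q) xs ys | _ \<Rightarrow> False)"

definition qpow :: "nat \<Rightarrow> 'a val qo \<Rightarrow> 'a val qo" where
  "qpow n Q = ({Wd xs | xs. set xs \<subseteq> fst Q \<and> length xs = n},
     \<lambda>x y. case (x, y) of (Wd xs, Wd ys) \<Rightarrow> list_all2 (snd Q) xs ys | _ \<Rightarrow> False)"

text \<open>Multiset embedding: an injection M -> M' mapping each element to a larger one.\<close>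
definition mset_emb :: "('v \<Rightarrow> 'v \<Rightarrow> bool) \<Rightarrow> 'v multiset \<Rightarrow> 'v multiset \<Rightarrow> bool" where
  "mset_emb le M M' \<longleftrightarrow> (\<exists>xs ys. mset xs = M \<and> mset ys \<subseteq># M' \<and> list_all2 le xs ys)"

definition qms :: "'a val qo \<Rightarrow> 'a val qo" where
  "qms Q = ({MS m | m. set_mset m \<subseteq> fst Q},
     \<lambda>x y. case (x, y) of (MS m, MS m') \<Rightarrow> mset_emb (snd Q) m m' | _ \<Rightarrow> False)"

definition qmsn :: "nat \<Rightarrow> 'a val qo \<Rightarrow> 'a val qo" where
  "qmsn n Q = ({MS m | m. set_mset m \<subseteq> fst Q \<and> size m = n},
     \<lambda>x y. case (x, y) of (MS m, MS m') \<Rightarrow> mset_emb (snd Q) m m' | _ \<Rightarrow> False)"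

definition qpf :: "'a val qo \<Rightarrow> 'a val qo" where
  "qpf Q = ({FS s | s. fset s \<subseteq> fst Q},
     \<lambda>x y. case (x, y) of (FS s, FS s') \<Rightarrow> (\<forall>a\<in>fset s. \<exists>b\<in>fset s'. snd Q a b) | _ \<Rightarrow> False)"

datatype 'a expr = EOrd "'a rel" | ESum "'a expr" "'a expr" | EProd "'a expr" "'a expr"
  | EStar "'a expr" | EMs "'a expr" | EPf "'a expr"

fun sem :: "'a expr \<Rightarrow> 'a val qo" where
  "sem (EOrd r) = qord r"
| "sem (ESum e1 e2) = qsum (sem e1) (sem e2)"
| "sem (EProd e1 e2) = qprod (sem e1) (sem e2)"
| "sem (EStar e) = qstar (sem e)"
| "sem (EMs e) = qms (sem e)"
| "sem (EPf e) = qpf (sem e)"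

fun elementary :: "'a expr \<Rightarrow> bool" where
  "elementary (EOrd r) = admissible_ord r"
| "elementary (ESum e1 e2) = (elementary e1 \<and> elementary e2)"
| "elementary (EProd e1 e2) = (elementary e1 \<and> elementary e2)"
| "elementary (EStar e) = elementary e"
| "elementary (EMs e) = elementary e"
| "elementary (EPf e) = elementary e"

fun is_redex :: "'a expr \<Rightarrow> bool" where
  "is_redex (EPf (EOrd _)) = True"
| "is_redex (EProd _ (ESum _ _)) = True"
| "is_redex (EProd (ESum _ _) _) = True"
| "is_redex (EMs (ESum _ _)) = True"
| "is_redex (EPf (ESum _ _)) = True"
| "is_redex _ = False"

fun normal_form :: "'a expr \<Rightarrow> bool" where
  "normal_form (EOrd r) = True"
| "normal_form (ESum e1 e2) = (normal_form e1 \<and> normal_form e2)"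
| "normal_form (EProd e1 e2) = (\<not> is_redex (EProd e1 e2) \<and> normal_form e1 \<and> normal_form e2)"
| "normal_form (EStar e) = normal_form e"
| "normal_form (EMs e) = (\<not> is_redex (EMs e) \<and> normal_form e)"
| "normal_form (EPf e) = (\<not> is_redex (EPf e) \<and> normal_form e)"

fun approx :: "'a expr \<Rightarrow> 'a val qo \<Rightarrow> bool" where
  "approx (EOrd r) Q = (\<exists>a\<in>Field r. wpo_iso Q (qord (seg r a)))"
| "approx (ESum e1 e2) Q = (\<exists>Q1 Q2. approx e1 Q1 \<and> approx e2 Q2 \<and> wpo_iso Q (qsum Q1 Q2))"
| "approx (EProd e1 e2) Q = (\<exists>Q1 Q2. approx e1 Q1 \<and> approx e2 Q2 \<and> wpo_iso Q (qprod Q1 Q2))"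
| "approx (EStar e) Q = (\<exists>Q1 n. approx e Q1 \<and> wpo_iso Q (qpow n Q1))"
| "approx (EMs e) Q = (\<exists>Q1 n. approx e Q1 \<and> wpo_iso Q (qmsn n Q1))"
| "approx (EPf e) Q = (\<exists>Q1. approx e Q1 \<and> wpo_iso Q (qpf Q1))"

definition bad_seq :: "'v qo \<Rightarrow> 'v list \<Rightarrow> bool" where
  "bad_seq Q xs \<longleftrightarrow> set xs \<subseteq> fst Q \<and>
     (\<forall>i j. i < j \<and> j < length xs \<longrightarrow> \<not> snd Q (xs ! i) (xs ! j))"

definition decr_seq :: "'v qo \<Rightarrow> 'v list \<Rightarrow> bool" where
  "decr_seq Q xs \<longleftrightarrow> set xs \<subseteq> fst Q \<and>
     (\<forall>i j. i < j \<and> j < length xs \<longrightarrow> snd Q (xs ! j) (xs ! i) \<and> \<not> snd Q (xs ! i) (xs ! j))"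

definition seq_child :: "('v list \<Rightarrow> bool) \<Rightarrow> 'v list \<Rightarrow> 'v list \<Rightarrow> bool" where
  "seq_child P t s \<longleftrightarrow> (\<exists>x. t = s @ [x]) \<and> P t"

text \<open>Comparison of ranks of nodes in two (well-founded) trees, given by child relations:
  r(x) <= r(y) iff every child x' of x has a child y' of y with r(x') <= r(y').
  For well-founded trees this is exactly the ordinal comparison of the ranks
  r(s) = sup { r(t)+1 : t child of s }.\<close>
inductive rank_le :: "('n \<Rightarrow> 'n \<Rightarrow> bool) \<Rightarrow> ('m \<Rightarrow> 'm \<Rightarrow> bool) \<Rightarrow> 'n \<Rightarrow> 'm \<Rightarrow> bool"
  for R :: "'n \<Rightarrow> 'n \<Rightarrow> bool" and S :: "'m \<Rightarrow> 'm \<Rightarrow> bool" where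
  "(\<forall>x'. R x' x \<longrightarrow> (\<exists>y'. S y' y \<and> rank_le R S x' y')) \<Longrightarrow> rank_le R S x y"

definition rank_eq :: "('n \<Rightarrow> 'n \<Rightarrow> bool) \<Rightarrow> 'n \<Rightarrow> ('m \<Rightarrow> 'm \<Rightarrow> bool) \<Rightarrow> 'm \<Rightarrow> bool" where
  "rank_eq R x S y \<longleftrightarrow> rank_le R S x y \<and> rank_le S R y x"

text \<open>Tree whose root rank is underline-o(E) = sup { o(E')+1 : E' <approx E }:
  the root None has as children the roots (E',[]) of the bad-sequence trees of all
  approximations E'.\<close>
definition osup_child :: "'a expr \<Rightarrow> ('a val qo \<times> 'a val list) option \<Rightarrow>
    ('a val qo \<times> 'a val list) option \<Rightarrow> bool" where
  "osup_child e t s = (case (t, s) of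
      (Some (Q, ys), None) \<Rightarrow> ys = [] \<and> approx e Q
    | (Some (Q, ys), Some (Q', xs)) \<Rightarrow> Q = Q' \<and> seq_child (bad_seq Q) ys xs
    | _ \<Rightarrow> False)"

end

(*
  A strictly decreasing sequence of finite sets under the Hoare order is a strictly decreasing
  sequence of finitely generated downsets. Below a finite set s it yields, by choosing at each step
  an element that disappears, a bad sequence in the downset of s; and the downset of s maps into some
  approximation by a map reflecting the order (words and multisets of bounded size are padded to a
  fixed size by an element lying above no other letter). Hence h(P_f(E)) is at most the supremum.

  Conversely let E' be an approximation of E. A bad sequence of E' strictly shrinks the downset of
  elements above none of its members. Since E' is a wqo, that downset is a finite union of ideals, and
  by induction on E the poset of ideals of E' (its ideal completion) embeds into E; so all these
  downsets are represented, with their inclusion order, by elements of P_f(E).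
*)

theory Submission
  imports Defs "HOL-Library.Ramsey"
begin

section \<open>Carriers and orders of the constructions\<close>

text \<open>The fixed sizes in \<open>qpow\<close> and \<open>qmsn\<close> shape both directions.
  For the upper bound they force a letter-by-letter comparison of words of different lengths; room
  for a harmless padding letter comes from 1 + \<alpha> = \<alpha> for infinite \<alpha>,
  transported through all constructors. For the lower bound they make embedding componentwise, so
  that ideals of a power are boxes of ideals. The ordinal base case works because passing from a
  segment to its ideals adds at most one point at the top, and the segment is strict. What
  multiplicative indecomposability contributes is the absence of a maximum: finitely many points
  always fit inside a strict segment. The finite-powerset constructor makes the lower bound
  interlock with itself: ideals of \<open>qpf Q\<close> correspond to downsets of \<open>Q\<close>,
  so the encoding of downsets by finite sets of ideals serves inside the induction as well as at its
  end.\<close>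

lemma fst_qord [simp]: "fst (qord r) = Atm ` Field r"
  and snd_qord [simp]: "snd (qord r) (Atm a) (Atm b) \<longleftrightarrow> (a, b) \<in> r"
  by (simp_all add: qord_def)

lemma fst_qsum [simp]: "fst (qsum Q R) = InL ` fst Q \<union> InR ` fst R"
  and snd_qsum [simp]: "snd (qsum Q R) (InL x) (InL x') \<longleftrightarrow> snd Q x x'"
    "snd (qsum Q R) (InR y) (InR y') \<longleftrightarrow> snd R y y'"
    "\<not> snd (qsum Q R) (InL x) (InR y)" "\<not> snd (qsum Q R) (InR y) (InL x)"
  by (simp_all add: qsum_def)

lemma fst_qprod: "fst (qprod Q R) = {Pr a b | a b. a \<in> fst Q \<and> b \<in> fst R}"
  and Pr_mem_qprod [simp]: "Pr a b \<in> fst (qprod Q R) \<longleftrightarrow> a \<in> fst Q \<and> b \<in> fst R"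
  and snd_qprod [simp]: "snd (qprod Q R) (Pr a b) (Pr a' b') \<longleftrightarrow> snd Q a a' \<and> snd R b b'"
  by (auto simp: qprod_def)

lemma fst_qstar: "fst (qstar Q) = {Wd xs | xs. set xs \<subseteq> fst Q}"
  and Wd_mem_qstar [simp]: "Wd xs \<in> fst (qstar Q) \<longleftrightarrow> set xs \<subseteq> fst Q"
  and snd_qstar [simp]: "snd (qstar Q) (Wd xs) (Wd ys) \<longleftrightarrow> list_emb (snd Q) xs ys"
  by (auto simp: qstar_def)

lemma fst_qpow: "fst (qpow n Q) = {Wd xs | xs. set xs \<subseteq> fst Q \<and> length xs = n}"
  and Wd_mem_qpow [simp]: "Wd xs \<in> fst (qpow n Q) \<longleftrightarrow> set xs \<subseteq> fst Q \<and> length xs = n"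
  and snd_qpow [simp]: "snd (qpow n Q) (Wd xs) (Wd ys) \<longleftrightarrow> list_all2 (snd Q) xs ys"
  by (auto simp: qpow_def)

lemma fst_qms: "fst (qms Q) = {MS m | m. set_mset m \<subseteq> fst Q}"
  and MS_mem_qms [simp]: "MS m \<in> fst (qms Q) \<longleftrightarrow> set_mset m \<subseteq> fst Q"
  and snd_qms [simp]: "snd (qms Q) (MS m) (MS m') \<longleftrightarrow> mset_emb (snd Q) m m'"
  by (auto simp: qms_def)

lemma fst_qmsn: "fst (qmsn n Q) = {MS m | m. set_mset m \<subseteq> fst Q \<and> size m = n}"
  and MS_mem_qmsn [simp]: "MS m \<in> fst (qmsn n Q) \<longleftrightarrow> set_mset m \<subseteq> fst Q \<and> size m = n"
  and snd_qmsn [simp]: "snd (qmsn n Q) (MS m) (MS m') \<longleftrightarrow> mset_emb (snd Q) m m'"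
  by (auto simp: qmsn_def)

lemma fst_qpf: "fst (qpf Q) = {FS s | s. fset s \<subseteq> fst Q}"
  and FS_mem_qpf [simp]: "FS s \<in> fst (qpf Q) \<longleftrightarrow> fset s \<subseteq> fst Q"
  and snd_qpf [simp]: "snd (qpf Q) (FS s) (FS s') \<longleftrightarrow> (\<forall>a\<in>fset s. \<exists>b\<in>fset s'. snd Q a b)"
  by (auto simp: qpf_def)

section \<open>Multiset embedding as a perfect matching with a submultiset\<close>

lemma mset_emb_iff_rel_mset: "mset_emb le M M' \<longleftrightarrow> (\<exists>N. N \<subseteq># M' \<and> rel_mset le M N)"
  by (auto simp: mset_emb_def rel_mset_def)

text \<open>Equal sizes force the submultiset hit by the embedding to be the whole target.\<close>

lemma mset_emb_same_size:
  assumes "size M = size M'"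
  shows "mset_emb le M M' \<longleftrightarrow> rel_mset le M M'"
  unfolding mset_emb_iff_rel_mset using assms
  by (metis mset_subset_size nat_less_le rel_mset_size subset_mset.dual_order.refl subset_mset.le_imp_less_or_eq)

lemma rel_mset_plusD:
  "rel_mset R (A + B) N \<Longrightarrow> \<exists>N1 N2. N = N1 + N2 \<and> rel_mset R A N1 \<and> rel_mset R B N2"
proof (induction A arbitrary: N)
  case (add a A)
  then obtain N1 b where N: "N = add_mset b N1" "R a b" "rel_mset R (A + B) N1"
    by (auto dest: msed_rel_invL)
  from add.IH[OF N(3)] obtain N2 N3 where "N1 = N2 + N3" "rel_mset R A N2" "rel_mset R B N3"
    by blast
  then show ?case
    using N by (intro exI[of _ "add_mset b N2"] exI[of _ N3]) (auto intro: rel_mset_Plus)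
qed auto

lemma rel_mset_plus_rightD:
  assumes "rel_mset R A (B + C)"
  shows "\<exists>A1 A2. A = A1 + A2 \<and> rel_mset R A1 B \<and> rel_mset R A2 C"
  using rel_mset_plusD[of "R\<inverse>\<inverse>" B C A] assms by (simp add: multiset.rel_conversep)

lemma mset_emb_mono:
  assumes "mset_emb R A B" and "\<And>x y. x \<in># A \<Longrightarrow> y \<in># B \<Longrightarrow> R x y \<Longrightarrow> S x y"
  shows "mset_emb S A B"
  using assms unfolding mset_emb_iff_rel_mset
  by (metis (no_types, lifting) mset_subset_eqD multiset.rel_mono_strong)

lemma mset_emb_image:
  assumes "mset_emb R A B" and "\<And>x y. x \<in># A \<Longrightarrow> y \<in># B \<Longrightarrow> R x y \<Longrightarrow> S (f x) (g y)"
  shows "mset_emb S (image_mset f A) (image_mset g B)"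
proof -
  obtain N where N: "N \<subseteq># B" "rel_mset R A N"
    using assms(1) by (auto simp: mset_emb_iff_rel_mset)
  have "rel_mset S (image_mset f A) (image_mset g N)"
    unfolding multiset.rel_map using N(2)
    by (rule multiset.rel_mono_strong) (use assms(2) N(1) in \<open>auto dest: mset_subset_eqD\<close>)
  then show ?thesis
    using N(1) by (auto simp: mset_emb_iff_rel_mset intro: image_mset_subseteq_mono)
qed

text \<open>No letter \<open>h x\<close> can be matched with the padding letter \<open>c\<close>, so
  the matching restricted to the genuine letters stays inside \<open>image_mset h m'\<close>;
  whatever \<open>P\<close> is matched with is discarded.\<close>

lemma mset_emb_cancel_padding:
  assumes emb: "mset_emb le (image_mset h m + P) (image_mset h m' + replicate_mset k c)"
    and c: "\<And>x. x \<in># m \<Longrightarrow> \<not> le (h x) c"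
  shows "mset_emb (\<lambda>x y. le (h x) (h y)) m m'"
proof -
  obtain N where N: "N \<subseteq># image_mset h m' + replicate_mset k c"
      "rel_mset le (image_mset h m + P) N"
    using emb by (auto simp: mset_emb_iff_rel_mset)
  then obtain N1 N2 where N12: "N = N1 + N2" "rel_mset le (image_mset h m) N1"
    by (blast dest: rel_mset_plusD)
  have "c \<notin># N1"
  proof
    assume "c \<in># N1"
    then obtain N1' where "N1 = N1' + {#c#}"
      by (metis add_mset_add_single insert_DiffM)
    with rel_mset_plus_rightD[of le _ N1' "{#c#}"] N12(2) obtain A1 A2
      where A: "image_mset h m = A1 + A2" "rel_mset le A2 {#c#}" by blast
    from msed_rel_invR[of le A2 c "{#}"] A(2) obtain a where "A2 = {#a#}" "le a c" by auto
    with A(1) have "a \<in> h ` set_mset m"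
      by (metis set_image_mset union_iff union_single_eq_member add.commute add_mset_add_single)
    with c \<open>le a c\<close> show False by blast
  qed
  \<comment> \<open>The part \<open>N1\<close> matched with genuine letters avoids \<open>c\<close>,
    and for every other letter the padding contributes nothing to the multiplicity.\<close>
  have "count N1 x \<le> count (image_mset h m') x" for x
  proof (cases "x = c")
    case False
    have "count N1 x \<le> count (image_mset h m' + replicate_mset k c) x"
      using N(1) N12(1) by (metis mset_subset_eq_add_left mset_subset_eq_count subset_mset.order_trans)
    with False show ?thesis by simp
  qed (use \<open>c \<notin># N1\<close> in \<open>simp add: not_in_iff\<close>)
  then have "N1 \<subseteq># image_mset h m'" by (rule mset_subset_eqI)
  then obtain C where "image_mset h m' = N1 + C" by (auto simp: subset_mset.le_iff_add)
  then obtain M1 C' where M1: "m' = M1 + C'" "N1 = image_mset h M1"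
    by (blast dest: image_mset_eq_plusD)
  have "rel_mset (\<lambda>x y. le (h x) (h y)) m M1"
    using N12(2) unfolding M1 multiset.rel_map .
  with M1(1) show ?thesis unfolding mset_emb_iff_rel_mset by (metis mset_subset_eq_add_left)
qed

lemma mset_emb_refl: "(\<And>x. x \<in># m \<Longrightarrow> le x x) \<Longrightarrow> mset_emb le m m"
  unfolding mset_emb_iff_rel_mset using multiset.rel_refl_strong by blast

lemma mset_emb_trans:
  assumes "mset_emb le A B" "mset_emb le B C"
    and tr: "\<And>x y z. x \<in># A \<Longrightarrow> y \<in># B \<Longrightarrow> z \<in># C \<Longrightarrow> le x y \<Longrightarrow> le y z \<Longrightarrow> le x z"
  shows "mset_emb le A C"
proof -
  obtain N where N: "N \<subseteq># B" "rel_mset le A N" using assms(1) by (auto simp: mset_emb_iff_rel_mset)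
  obtain L where L: "L \<subseteq># C" "rel_mset le B L" using assms(2) by (auto simp: mset_emb_iff_rel_mset)
  obtain N' where "B = N + N'" using N(1) by (auto simp: subset_mset.le_iff_add)
  then obtain L1 L2 where L12: "L = L1 + L2" "rel_mset le N L1"
    using L(2) by (blast dest: rel_mset_plusD)
  have sub: "L1 \<subseteq># C" using L(1) L12(1) by (metis mset_subset_eq_add_left subset_mset.order_trans)
  \<comment> \<open>Both matchings are decorated with membership, because transitivity is available
    only for members of the three multisets.\<close>
  have 1: "rel_mset (\<lambda>x y. le x y \<and> x \<in># A \<and> y \<in># B) A N"
    using N(2) by (rule multiset.rel_mono_strong) (use N(1) in \<open>auto dest: mset_subset_eqD\<close>)
  have 2: "rel_mset (\<lambda>x y. le x y \<and> y \<in># C) N L1"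
    using L12(2) by (rule multiset.rel_mono_strong) (use sub in \<open>auto dest: mset_subset_eqD\<close>)
  have "rel_mset ((\<lambda>x y. le x y \<and> x \<in># A \<and> y \<in># B) OO (\<lambda>x y. le x y \<and> y \<in># C)) A L1"
    using 1 2 by (auto simp: multiset.rel_compp)
  then have "rel_mset le A L1"
    by (rule multiset.rel_mono_strong) (use tr in blast)
  with sub show ?thesis by (auto simp: mset_emb_iff_rel_mset)
qed


section \<open>Quasi-orders\<close>

lemma quasi_orderI:
  assumes "\<And>x. x \<in> fst Q \<Longrightarrow> snd Q x x"
    and "\<And>x y z. x \<in> fst Q \<Longrightarrow> y \<in> fst Q \<Longrightarrow> z \<in> fst Q \<Longrightarrow> snd Q x y \<Longrightarrow> snd Q y z \<Longrightarrow> snd Q x z"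
  shows "quasi_order Q"
  unfolding quasi_order_def using assms by blast

lemma qo_refl: "quasi_order Q \<Longrightarrow> x \<in> fst Q \<Longrightarrow> snd Q x x"
  by (simp add: quasi_order_def)

lemma qo_trans:
  "quasi_order Q \<Longrightarrow> snd Q x y \<Longrightarrow> snd Q y z \<Longrightarrow> x \<in> fst Q \<Longrightarrow> y \<in> fst Q \<Longrightarrow> z \<in> fst Q \<Longrightarrow> snd Q x z"
  unfolding quasi_order_def by blast

lemma quasi_order_qord:
  assumes "Well_order r"
  shows "quasi_order (qord r)"
proof (rule quasi_orderI)
  have *: "refl_on (Field r) r" "trans r"
    using assms by (auto simp: well_order_on_def linear_order_on_def partial_order_on_def preorder_on_def)
  show "snd (qord r) x x" if "x \<in> fst (qord r)" for x
    using that * by (auto dest: refl_onD)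
  show "snd (qord r) x z" if "x \<in> fst (qord r)" "y \<in> fst (qord r)" "z \<in> fst (qord r)"
    "snd (qord r) x y" "snd (qord r) y z" for x y z
    using that * by (auto dest: transD)
qed

lemma quasi_order_qsum:
  assumes "quasi_order Q" "quasi_order R"
  shows "quasi_order (qsum Q R)"
proof (rule quasi_orderI)
  show "snd (qsum Q R) x x" if "x \<in> fst (qsum Q R)" for x
    using that assms by (auto intro: qo_refl)
  show "snd (qsum Q R) x z" if "x \<in> fst (qsum Q R)" "y \<in> fst (qsum Q R)" "z \<in> fst (qsum Q R)"
    "snd (qsum Q R) x y" "snd (qsum Q R) y z" for x y z
    using that assms by (auto intro: qo_trans)
qed

lemma quasi_order_qprod:
  assumes "quasi_order Q" "quasi_order R"
  shows "quasi_order (qprod Q R)"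
proof (rule quasi_orderI)
  show "snd (qprod Q R) x x" if "x \<in> fst (qprod Q R)" for x
    using that assms by (auto simp: fst_qprod intro: qo_refl)
  show "snd (qprod Q R) x z" if "x \<in> fst (qprod Q R)" "y \<in> fst (qprod Q R)" "z \<in> fst (qprod Q R)"
    "snd (qprod Q R) x y" "snd (qprod Q R) y z" for x y z
    using that by (clarsimp simp: fst_qprod) (meson assms qo_trans)
qed

lemma quasi_order_qstar:
  assumes "quasi_order Q"
  shows "quasi_order (qstar Q)"
proof (rule quasi_orderI)
  show "snd (qstar Q) x x" if "x \<in> fst (qstar Q)" for x
    using that by (auto simp: fst_qstar intro!: list_emb_refl qo_refl[OF assms])
  show "snd (qstar Q) x z" if "x \<in> fst (qstar Q)" "y \<in> fst (qstar Q)" "z \<in> fst (qstar Q)"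
    "snd (qstar Q) x y" "snd (qstar Q) y z" for x y z
    using that list_emb_trans[of _ _ _ "snd Q"]
    by (clarsimp simp: fst_qstar) (meson assms qo_trans subsetD)
qed

lemma quasi_order_qpow:
  assumes "quasi_order Q"
  shows "quasi_order (qpow n Q)"
proof (rule quasi_orderI)
  show "snd (qpow n Q) x x" if "x \<in> fst (qpow n Q)" for x
    using that by (auto simp: fst_qpow list_all2_same intro!: qo_refl[OF assms])
  show "snd (qpow n Q) x z" if "x \<in> fst (qpow n Q)" "y \<in> fst (qpow n Q)" "z \<in> fst (qpow n Q)"
    "snd (qpow n Q) x y" "snd (qpow n Q) y z" for x y z
    using that
    by (clarsimp simp: fst_qpow list_all2_conv_all_nth) (rule qo_trans[OF assms], auto)
qed

lemma quasi_order_qms: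
  assumes "quasi_order Q"
  shows "quasi_order (qms Q)"
proof (rule quasi_orderI)
  show "snd (qms Q) x x" if "x \<in> fst (qms Q)" for x
    using that by (auto simp: fst_qms intro!: mset_emb_refl qo_refl[OF assms])
  show "snd (qms Q) x z" if "x \<in> fst (qms Q)" "y \<in> fst (qms Q)" "z \<in> fst (qms Q)"
    "snd (qms Q) x y" "snd (qms Q) y z" for x y z
    using that by (clarsimp simp: fst_qms) (erule (1) mset_emb_trans, meson assms qo_trans subsetD)
qed

lemma quasi_order_qmsn:
  assumes "quasi_order Q"
  shows "quasi_order (qmsn n Q)"
proof -
  have "fst (qmsn n Q) \<subseteq> fst (qms Q)" and eq: "snd (qmsn n Q) = snd (qms Q)"
    by (auto simp: qms_def qmsn_def)
  then have "x \<in> fst (qms Q)" if "x \<in> fst (qmsn n Q)" for x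
    using that by blast
  then show ?thesis
    using quasi_order_qms[OF assms] by (intro quasi_orderI) (auto simp: eq intro: qo_refl qo_trans)
qed

lemma quasi_order_qpf:
  assumes "quasi_order Q"
  shows "quasi_order (qpf Q)"
proof (rule quasi_orderI)
  show "snd (qpf Q) x x" if "x \<in> fst (qpf Q)" for x
    using that by (clarsimp simp: fst_qpf) (meson assms qo_refl subsetD)
  show "snd (qpf Q) x z" if "x \<in> fst (qpf Q)" "y \<in> fst (qpf Q)" "z \<in> fst (qpf Q)"
    "snd (qpf Q) x y" "snd (qpf Q) y z" for x y z
    using that by (clarsimp simp: fst_qpf) (meson assms qo_trans subsetD)
qed

lemma quasi_order_sem: "elementary e \<Longrightarrow> quasi_order (sem e)"
  by (induction e)
    (auto simp: admissible_ord_def mult_indec_def intro!: quasi_order_qord quasi_order_qsum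
      quasi_order_qprod quasi_order_qstar quasi_order_qms quasi_order_qpf)

section \<open>Well-quasi-orders\<close>

lemma wqo_qo: "wqo Q \<Longrightarrow> quasi_order Q"
  by (simp add: wqo_def)

lemma wqoD: "wqo Q \<Longrightarrow> (\<And>i. f i \<in> fst Q) \<Longrightarrow> \<exists>i j. i < j \<and> snd Q (f i) (f (j::nat))"
  by (simp add: wqo_def)

lemma wqoI:
  "quasi_order Q \<Longrightarrow> (\<And>f. (\<And>i. f i \<in> fst Q) \<Longrightarrow> \<exists>i j. i < j \<and> snd Q (f i) (f (j::nat))) \<Longrightarrow> wqo Q"
  by (simp add: wqo_def)

text \<open>Ramsey's theorem for pairs of indices, coloured by whether the earlier value lies below
  the later one: a homogeneous set of the negative colour would be a bad sequence.\<close>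

lemma wqo_subseq:
  assumes "wqo Q" and f: "\<And>i::nat. f i \<in> fst Q"
  shows "\<exists>h. strict_mono (h::nat \<Rightarrow> nat) \<and> (\<forall>i j. i < j \<longrightarrow> snd Q (f (h i)) (f (h j)))"
proof -
  \<comment> \<open>\<open>Min\<close> and \<open>Max\<close> recover the order of the two indices
    from the unordered pair.\<close>
  define col where "col X = (if snd Q (f (Min X)) (f (Max X)) then 0 else Suc 0)" for X
  have "\<forall>x\<in>UNIV. \<forall>y\<in>UNIV. x \<noteq> y \<longrightarrow> col {x, y} < 2" by (simp add: col_def)
  from Ramsey2[OF infinite_UNIV_nat this]
  obtain Y t where Y: "infinite Y" and hom: "\<forall>x\<in>Y. \<forall>y\<in>Y. x \<noteq> y \<longrightarrow> col {x, y} = t"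
    by (elim exE conjE)
  define h where "h = enumerate Y"
  have h: "strict_mono h" "\<And>i. h i \<in> Y"
    using Y by (auto simp: h_def strict_mono_enumerate enumerate_in_set)
  have col: "col {h i, h j} = t" "col {h i, h j} = (if snd Q (f (h i)) (f (h j)) then 0 else Suc 0)"
    if "i < j" for i j
  proof -
    have "h i < h j" using h(1) that by (simp add: strict_mono_less)
    then show "col {h i, h j} = t" using hom h(2) by simp
    show "col {h i, h j} = (if snd Q (f (h i)) (f (h j)) then 0 else Suc 0)"
      using \<open>h i < h j\<close> by (simp add: col_def)
  qed
  obtain i j where "i < j" "snd Q (f (h i)) (f (h j))"
    using wqoD[OF assms(1), of "f \<circ> h"] f by auto
  then have "t = 0" using col[of i j] by simp
  then have "snd Q (f (h i)) (f (h j))" if "i < j" for i j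
    using col[OF that] by (simp split: if_splits)
  with h(1) show ?thesis by blast
qed

lemma wqo_reflect:
  assumes "quasi_order Q" "wqo R"
    and f: "\<And>x. x \<in> fst Q \<Longrightarrow> f x \<in> fst R"
      "\<And>x y. x \<in> fst Q \<Longrightarrow> y \<in> fst Q \<Longrightarrow> snd R (f x) (f y) \<Longrightarrow> snd Q x y"
  shows "wqo Q"
proof (rule wqoI)
  fix s :: "nat \<Rightarrow> _" assume "\<And>i. s i \<in> fst Q"
  then show "\<exists>i j. i < j \<and> snd Q (s i) (s j)"
    using wqoD[OF assms(2), of "f \<circ> s"] f by simp metis
qed fact

lemma wqo_qord:
  assumes r: "Well_order r"
  shows "wqo (qord r)"
proof (rule wqoI)
  fix f :: "nat \<Rightarrow> 'a val" assume "\<And>i. f i \<in> fst (qord r)"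
  then obtain a where a: "\<And>i. a i \<in> Field r" "\<And>i. f i = Atm (a i)"
    by (simp add: image_iff) metis
  have "\<not> (\<forall>i. (a (Suc i), a i) \<in> r - Id)"
    using r by (meson well_order_on_def wf_iff_no_infinite_down_chain)
  then obtain i where "(a (Suc i), a i) \<notin> r - Id" by blast
  moreover have "total_on (Field r) r" "refl_on (Field r) r"
    using r by (auto simp: well_order_on_def linear_order_on_def partial_order_on_def preorder_on_def)
  ultimately have "(a i, a (Suc i)) \<in> r"
    using a(1) by (metis DiffI pair_in_Id_conv refl_onD total_on_def)
  then show "\<exists>i j. i < j \<and> snd (qord r) (f i) (f j)"
    using a(2) by (metis lessI snd_qord)
qed (rule quasi_order_qord[OF r])

text \<open>One summand is visited infinitely often, and a good pair is found along those
  indices.\<close>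

lemma wqo_qsum:
  assumes "wqo Q" "wqo R"
  shows "wqo (qsum Q R)"
proof (rule wqoI)
  fix f :: "nat \<Rightarrow> 'a val" assume f: "\<And>i. f i \<in> fst (qsum Q R)"
  have good: "\<exists>i j. i < j \<and> snd (qsum Q R) (f i) (f j)"
    if inf: "infinite {i. f i \<in> c ` fst P}" and P: "wqo P"
      and c: "\<And>x y. snd (qsum Q R) (c x) (c y) \<longleftrightarrow> snd P x y" for c P
  proof -
    define h where "h = enumerate {i. f i \<in> c ` fst P}"
    have h: "strict_mono h" "\<And>i. f (h i) \<in> c ` fst P"
      using strict_mono_enumerate[OF inf] enumerate_in_set[OF inf] by (auto simp: h_def)
    then obtain g where g: "\<And>i. g i \<in> fst P" "\<And>i. f (h i) = c (g i)"
      by (simp add: image_iff) metis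
    obtain i j where "i < j" "snd P (g i) (g j)" using wqoD[OF P g(1)] by blast
    then show ?thesis using g(2) c h(1) by (metis strict_mono_less)
  qed
  have "{i. f i \<in> InL ` fst Q} \<union> {i. f i \<in> InR ` fst R} = UNIV" using f by auto
  then have "infinite {i. f i \<in> InL ` fst Q} \<or> infinite {i. f i \<in> InR ` fst R}"
    by (metis finite_Un infinite_UNIV_nat)
  then show "\<exists>i j. i < j \<and> snd (qsum Q R) (f i) (f j)"
    using good[of InL Q] good[of InR R] assms by auto
qed (use assms in \<open>blast intro: quasi_order_qsum wqo_qo\<close>)

lemma wqo_qprod:
  assumes "wqo Q" "wqo R"
  shows "wqo (qprod Q R)"
proof (rule wqoI)
  fix f :: "nat \<Rightarrow> 'a val" assume "\<And>i. f i \<in> fst (qprod Q R)"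
  then have "\<forall>i. \<exists>x y. f i = Pr x y \<and> x \<in> fst Q \<and> y \<in> fst R" by (auto simp: fst_qprod)
  then obtain a b where ab: "\<And>i. f i = Pr (a i) (b i)" "\<And>i. a i \<in> fst Q" "\<And>i. b i \<in> fst R"
    by metis
  obtain h where h: "strict_mono (h::nat \<Rightarrow> nat)" "\<And>i j. i < j \<Longrightarrow> snd Q (a (h i)) (a (h j))"
    using wqo_subseq[OF assms(1), of a] ab(2) by blast
  obtain i j where "i < j" "snd R (b (h i)) (b (h j))"
    using wqoD[OF assms(2), of "b \<circ> h"] ab(3) by auto
  then show "\<exists>i j. i < j \<and> snd (qprod Q R) (f i) (f j)"
    using h ab(1) by (metis snd_qprod strict_mono_less)
qed (use assms in \<open>blast intro: quasi_order_qprod wqo_qo\<close>)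

text \<open>Splitting off the first letter reflects the componentwise order into a product with a
  shorter power.\<close>

lemma wqo_qpow:
  assumes "wqo Q"
  shows "wqo (qpow n Q)"
proof (induction n)
  case 0
  show ?case
  proof (rule wqoI)
    fix f :: "nat \<Rightarrow> 'a val" assume "\<And>i. f i \<in> fst (qpow 0 Q)"
    then have "\<And>i. f i = Wd []" by (auto simp: fst_qpow)
    then show "\<exists>i j. i < j \<and> snd (qpow 0 Q) (f i) (f j)" by auto
  qed (use assms in \<open>blast intro: quasi_order_qpow wqo_qo\<close>)
next
  case (Suc n)
  define f where "f w = (case w of Wd (x # xs) \<Rightarrow> Pr x (Wd xs) | _ \<Rightarrow> w)" for w :: "'a val"
  show ?case
  proof (rule wqo_reflect[of _ "qprod Q (qpow n Q)" f])
    show "snd (qpow (Suc n) Q) x y"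
      if "x \<in> fst (qpow (Suc n) Q)" "y \<in> fst (qpow (Suc n) Q)"
        "snd (qprod Q (qpow n Q)) (f x) (f y)" for x y
      using that by (auto simp: fst_qpow f_def length_Suc_conv)
  qed (use assms Suc in \<open>auto intro: quasi_order_qpow wqo_qprod wqo_qo simp: fst_qpow f_def length_Suc_conv\<close>)
qed

lemma wqo_qmsn:
  assumes "wqo Q"
  shows "wqo (qmsn n Q)"
proof -
  \<comment> \<open>Arbitrary listings reflect the order: a letterwise comparison of two listings is
    a matching of the multisets.\<close>
  define f where "f w = (case w of MS m \<Rightarrow> Wd (SOME xs. mset xs = m) | _ \<Rightarrow> w)" for w :: "'a val"
  have f: "\<exists>xs. f (MS m) = Wd xs \<and> mset xs = m" for m
    by (simp add: f_def) (metis (mono_tags, lifting) ex_mset someI_ex)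
  show ?thesis
  proof (rule wqo_reflect[of _ "qpow n Q" f])
    fix x y assume "x \<in> fst (qmsn n Q)" "y \<in> fst (qmsn n Q)" and le: "snd (qpow n Q) (f x) (f y)"
    then obtain m m' where m: "x = MS m" "y = MS m'" by (auto simp: fst_qmsn)
    obtain xs ys where xs: "f x = Wd xs" "mset xs = m" "f y = Wd ys" "mset ys = m'"
      using f m by blast
    then have "list_all2 (snd Q) xs ys" using le by simp
    then show "snd (qmsn n Q) x y" using m xs by (auto simp: mset_emb_def)
  next
    fix x assume "x \<in> fst (qmsn n Q)"
    then obtain m where m: "x = MS m" "set_mset m \<subseteq> fst Q" "size m = n" by (auto simp: fst_qmsn)
    obtain xs where "f x = Wd xs" "mset xs = m" using f m(1) by blast
    then show "f x \<in> fst (qpow n Q)" using m by auto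
  qed (use assms in \<open>auto intro: quasi_order_qmsn wqo_qpow wqo_qo\<close>)
qed

text \<open>Higman's lemma is not needed here: if no set of a sequence is dominated by a later one, the
  witnesses can, by finiteness of the sets and the pigeonhole principle, be chosen independently of
  the later set along a subsequence, and then form a bad sequence of elements.\<close>
lemma wqo_qpf:
  assumes "wqo Q"
  shows "wqo (qpf Q)"
proof (rule wqoI[OF quasi_order_qpf[OF wqo_qo[OF assms]]], rule ccontr)
  fix f :: "nat \<Rightarrow> 'a val"
  assume "\<And>i. f i \<in> fst (qpf Q)" and bad: "\<nexists>i j. i < j \<and> snd (qpf Q) (f i) (f j)"
  then have "\<forall>i. \<exists>s. f i = FS s \<and> fset s \<subseteq> fst Q" by (auto simp: fst_qpf)
  then obtain S where S: "\<And>i. f i = FS (S i)" "\<And>i. fset (S i) \<subseteq> fst Q" by metis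
  define esc where "esc x j \<longleftrightarrow> (\<forall>b\<in>fset (S j). \<not> snd Q x b)" for x j
  have esc: "\<exists>x\<in>fset (S i). esc x j" if "i < j" for i j
    using bad that S(1) unfolding esc_def by (metis snd_qpf)
  have step: "\<exists>N' i x. infinite N' \<and> x \<in> fset (S i) \<and> (\<forall>j\<in>N'. esc x j) \<and> N' \<subseteq> N \<and> i \<in> N"
    if N: "infinite N" for N
  proof -
    obtain i where i: "i \<in> N" using N by fastforce
    have "infinite (N - {..i})" using N by simp
    moreover have "\<forall>j\<in>N - {..i}. \<exists>x\<in>fset (S i). esc x j" using esc by auto
    ultimately obtain x where "x \<in> fset (S i)" "infinite {j \<in> N - {..i}. esc x j}"
      using pigeonhole_infinite_rel[of "N - {..i}" "fset (S i)" "\<lambda>j x. esc x j"] by auto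
    with i show ?thesis by (intro exI[of _ "{j \<in> N - {..i}. esc x j}"]) auto
  qed
  \<comment> \<open>A state consists of a set \<open>N\<close> of indices, an index \<open>i\<close>
    and a witness \<open>x\<close> in \<open>S i\<close> that escapes every set indexed by
    \<open>N\<close>. The next index is drawn from \<open>N\<close>, so \<open>x\<close> is below no
    later witness.\<close>
  define P where "P = (\<lambda>(n::nat) (N, i, x). infinite N \<and> x \<in> fset (S i) \<and> (\<forall>j\<in>N. esc x j))"
  have "\<exists>g. \<forall>n. P n (g n) \<and> (case g n of (N, i, x) \<Rightarrow> case g (Suc n) of (N', i', x') \<Rightarrow> N' \<subseteq> N \<and> i' \<in> N)"
  proof (rule dependent_nat_choice)
    show "\<exists>t. P 0 t" using step[OF infinite_UNIV_nat] by (auto simp: P_def)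
    show "\<exists>u. P (Suc n) u \<and> (case t of (N, i, x) \<Rightarrow> case u of (N', i', x') \<Rightarrow> N' \<subseteq> N \<and> i' \<in> N)"
      if "P n t" for n t
    proof -
      obtain N i x where "t = (N, i, x)" by (cases t)
      with that show ?thesis using step[of N] by (auto simp: P_def)
    qed
  qed
  then obtain g where g: "\<And>n. P n (g n)"
      "\<And>n. fst (g (Suc n)) \<subseteq> fst (g n) \<and> fst (snd (g (Suc n))) \<in> fst (g n)"
    by (auto simp: case_prod_beta)
  define x where "x n = snd (snd (g n))" for n
  have x: "x n \<in> fset (S (fst (snd (g n))))" "\<And>j. j \<in> fst (g n) \<Longrightarrow> esc (x n) j" for n
    using g(1)[of n] by (auto simp: P_def x_def case_prod_beta)
  have mono: "fst (g n) \<subseteq> fst (g m)" if "m \<le> n" for m n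
    using lift_Suc_antimono_le[of "\<lambda>n. fst (g n)", OF _ that] g(2) by blast
  have "\<not> snd Q (x m) (x n)" if "m < n" for m n
  proof -
    obtain k where k: "n = Suc k" "m \<le> k" using \<open>m < n\<close> by (cases n) auto
    have "fst (snd (g n)) \<in> fst (g m)" using g(2)[of k] mono[OF k(2)] k(1) by blast
    then show ?thesis using x(2) x(1)[of n] unfolding esc_def by blast
  qed
  moreover have "x n \<in> fst Q" for n using x(1) S(2) by blast
  ultimately show False using wqoD[OF assms, of x] by blast
qed

section \<open>Isomorphism of quotients\<close>

lemma qle_qclass:
  assumes "quasi_order Q" "x \<in> fst Q" "y \<in> fst Q"
  shows "qle Q (qclass Q x) (qclass Q y) \<longleftrightarrow> snd Q x y"
proof
  show "snd Q x y" if "qle Q (qclass Q x) (qclass Q y)"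
    using that assms unfolding qle_def qclass_def by (auto intro: qo_trans)
  show "qle Q (qclass Q x) (qclass Q y)" if "snd Q x y"
    using that assms unfolding qle_def qclass_def by (auto intro: qo_refl)
qed

lemma wpo_iso_refl: "quasi_order Q \<Longrightarrow> wpo_iso Q Q"
  unfolding wpo_iso_def by (auto intro!: exI[of _ id])

text \<open>The isomorphism acts on equivalence classes; choosing representatives gives an order
  embedding of the carriers that is onto only up to equivalence.\<close>

lemma wpo_iso_map:
  assumes "wpo_iso Q R"
  obtains f where "\<And>x. x \<in> fst Q \<Longrightarrow> f x \<in> fst R"
    "\<And>x y. x \<in> fst Q \<Longrightarrow> y \<in> fst Q \<Longrightarrow> snd R (f x) (f y) \<longleftrightarrow> snd Q x y"
    "\<And>y. y \<in> fst R \<Longrightarrow> \<exists>x\<in>fst Q. snd R (f x) y \<and> snd R y (f x)"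
proof -
  obtain g where qo: "quasi_order Q" "quasi_order R" and g: "bij_betw g (quot Q) (quot R)"
    and le: "\<And>C D. C \<in> quot Q \<Longrightarrow> D \<in> quot Q \<Longrightarrow> qle Q C D \<longleftrightarrow> qle R (g C) (g D)"
    using assms by (auto simp: wpo_iso_def)
  have "\<exists>y\<in>fst R. g (qclass Q x) = qclass R y" if "x \<in> fst Q" for x
    using that g unfolding bij_betw_def quot_def by blast
  then obtain f where f: "\<And>x. x \<in> fst Q \<Longrightarrow> f x \<in> fst R \<and> g (qclass Q x) = qclass R (f x)"
    by metis
  have 2: "snd R (f x) (f y) \<longleftrightarrow> snd Q x y" if "x \<in> fst Q" "y \<in> fst Q" for x y
    using le[of "qclass Q x" "qclass Q y"] f[OF that(1)] f[OF that(2)] that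
    by (simp add: quot_def qle_qclass qo)
  have 3: "\<exists>x\<in>fst Q. snd R (f x) y \<and> snd R y (f x)" if "y \<in> fst R" for y
  proof -
    have "qclass R y \<in> g ` quot Q" using g that by (auto simp: bij_betw_def quot_def)
    then obtain x where x: "x \<in> fst Q" "qclass R y = qclass R (f x)"
      using f by (auto simp: quot_def)
    have "y \<in> qclass R (f x)" using x(2) that qo(2) by (auto simp: qclass_def intro: qo_refl)
    then show ?thesis using x(1) by (auto simp: qclass_def)
  qed
  show thesis by (rule that[of f]) (use f 2 3 in blast)+
qed

lemma wqo_wpo_iso:
  assumes "wpo_iso Q R" "wqo R"
  shows "wqo Q"
proof -
  obtain f where "\<And>x. x \<in> fst Q \<Longrightarrow> f x \<in> fst R"
    "\<And>x y. x \<in> fst Q \<Longrightarrow> y \<in> fst Q \<Longrightarrow> snd R (f x) (f y) \<longleftrightarrow> snd Q x y"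
    using assms(1) by (rule wpo_iso_map) blast
  then show ?thesis using assms by (intro wqo_reflect[of Q R f]) (auto simp: wpo_iso_def)
qed

lemma Well_order_seg: "Well_order r \<Longrightarrow> Well_order (seg r a)"
  by (simp add: seg_def Well_order_Restr)

text \<open>Sizes are fixed in an approximation, so closure of wqos under sums, products, finite
  powers and finite powersets covers the inductive cases.\<close>

lemma approx_wqo: "elementary e \<Longrightarrow> approx e Q \<Longrightarrow> wqo Q"
proof (induction e arbitrary: Q)
  case (EOrd r)
  then show ?case
    by (auto simp: admissible_ord_def mult_indec_def intro!: wqo_wpo_iso[OF _ wqo_qord] Well_order_seg)
qed (simp_all only: approx.simps elementary.simps,
    (meson wqo_wpo_iso wqo_qsum wqo_qprod wqo_qpow wqo_qmsn wqo_qpf)+)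

section \<open>Ideals\<close>

definition downset :: "'v qo \<Rightarrow> 'v set \<Rightarrow> bool" where
  "downset Q D \<longleftrightarrow> D \<subseteq> fst Q \<and> (\<forall>x\<in>D. \<forall>y\<in>fst Q. snd Q y x \<longrightarrow> y \<in> D)"

definition ideals :: "'v qo \<Rightarrow> 'v set set" where
  "ideals Q = {I. downset Q I \<and> I \<noteq> {} \<and> (\<forall>x\<in>I. \<forall>y\<in>I. \<exists>z\<in>I. snd Q x z \<and> snd Q y z)}"

lemma downsetD: "downset Q D \<Longrightarrow> x \<in> D \<Longrightarrow> y \<in> fst Q \<Longrightarrow> snd Q y x \<Longrightarrow> y \<in> D"
  by (auto simp: downset_def)

lemma idealsD:
  assumes "I \<in> ideals Q"
  shows "downset Q I" "I \<noteq> {}" "I \<subseteq> fst Q"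
    and "x \<in> I \<Longrightarrow> y \<in> I \<Longrightarrow> \<exists>z\<in>I. snd Q x z \<and> snd Q y z"
  using assms by (auto simp: ideals_def downset_def)

lemma idealsI:
  assumes "downset Q I" "I \<noteq> {}"
    and "\<And>x y. x \<in> I \<Longrightarrow> y \<in> I \<Longrightarrow> \<exists>z\<in>I. snd Q x z \<and> snd Q y z"
  shows "I \<in> ideals Q"
  using assms by (auto simp: ideals_def)

lemma ideal_finite_ub:
  assumes "quasi_order Q" "I \<in> ideals Q" "finite S" "S \<subseteq> I"
  shows "\<exists>z\<in>I. \<forall>x\<in>S. snd Q x z"
  using assms(3,4)
proof (induction S rule: finite_induct)
  case empty
  then show ?case using idealsD(2)[OF assms(2)] by blast
next
  case (insert x S)
  then obtain y where y: "y \<in> I" "\<forall>x\<in>S. snd Q x y" by blast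
  obtain z where z: "z \<in> I" "snd Q x z" "snd Q y z"
    using idealsD(4)[OF assms(2), of x y] insert.prems y(1) by blast
  have "snd Q u z" if "u \<in> S" for u
    using that y z insert.prems idealsD(3)[OF assms(2)] by (blast intro: qo_trans[OF assms(1)])
  with z show ?case by blast
qed

text \<open>Otherwise \<open>I\<close> contains, for each of the finitely many downsets, an element
  outside it; an upper bound of these elements in \<open>I\<close> would belong to none of the
  downsets.\<close>

lemma ideal_prime:
  assumes qo: "quasi_order Q" and I: "I \<in> ideals Q"
    and D: "finite \<D>" "\<And>D. D \<in> \<D> \<Longrightarrow> downset Q D" "I \<subseteq> \<Union>\<D>"
  shows "\<exists>D\<in>\<D>. I \<subseteq> D"
proof (rule ccontr)
  assume "\<not> (\<exists>D\<in>\<D>. I \<subseteq> D)"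
  then have "\<forall>D\<in>\<D>. \<exists>x. x \<in> I \<and> x \<notin> D" by blast
  then obtain x where x: "\<And>D. D \<in> \<D> \<Longrightarrow> x D \<in> I \<and> x D \<notin> D" by metis
  then obtain z where z: "z \<in> I" "\<forall>u\<in>x ` \<D>. snd Q u z"
    using ideal_finite_ub[OF qo I, of "x ` \<D>"] D(1) by blast
  then obtain E where "E \<in> \<D>" "z \<in> E" using D(3) by blast
  then show False
    using z(2) x[of E] D(2)[of E] idealsD(3)[OF I] by (blast dest: downsetD)
qed

text \<open>Choosing an element lost at each step of an infinite strict descent produces a bad
  sequence.\<close>

lemma wqo_downset_wf:
  assumes "wqo Q"
  shows "wf {(D, E). downset Q D \<and> downset Q E \<and> D \<subset> E}"
  unfolding wf_iff_no_infinite_down_chain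
proof
  assume "\<exists>f. \<forall>i. (f (Suc i), f i) \<in> {(D, E). downset Q D \<and> downset Q E \<and> D \<subset> E}"
  then obtain f where f: "\<And>i. downset Q (f i)" "\<And>i. f (Suc i) \<subset> f i" by blast
  then have "\<forall>i. \<exists>x. x \<in> f i \<and> x \<notin> f (Suc i)" by blast
  then obtain x where x: "\<And>i. x i \<in> f i" "\<And>i. x i \<notin> f (Suc i)" by metis
  have Q: "x i \<in> fst Q" for i using x(1) f(1) by (auto simp: downset_def)
  then obtain i j where ij: "i < j" "snd Q (x i) (x j)" using wqoD[OF assms] by blast
  have "f j \<subseteq> f (Suc i)"
    using lift_Suc_antimono_le[of f "Suc i" j] f(2) ij(1) by (simp add: Suc_le_eq psubset_imp_subset)
  then have "x i \<in> f (Suc i)" using x(1)[of j] ij(2) f(1) Q by (blast dest: downsetD)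
  with x(2) show False by blast
qed

text \<open>If a nonempty \<open>D\<close> is not directed, some \<open>x\<close> and
  \<open>y\<close> in \<open>D\<close> have no common upper bound in \<open>D\<close>. Then
  \<open>D\<close> is the union of its elements not above \<open>x\<close> and its elements not
  above \<open>y\<close>, two strictly smaller downsets.\<close>

lemma downset_finite_Union_ideals:
  assumes wqo: "wqo Q" and "downset Q D"
  shows "\<exists>\<I>. finite \<I> \<and> \<I> \<subseteq> ideals Q \<and> \<Union>\<I> = D"
  using assms(2)
proof (induction D rule: wf_induct_rule[OF wqo_downset_wf[OF wqo]])
  case (1 D)
  note qo = wqo_qo[OF wqo]
  show ?case
  proof (cases "D = {} \<or> D \<in> ideals Q")
    case True
    then show ?thesis by (auto intro: exI[of _ "{}"] exI[of _ "{D}"])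
  next
    case False
    then obtain x y where xy: "x \<in> D" "y \<in> D" "\<And>z. z \<in> D \<Longrightarrow> \<not> (snd Q x z \<and> snd Q y z)"
      using idealsI[OF 1(2)] by blast
    have D: "D \<subseteq> fst Q" using 1(2) by (simp add: downset_def)
    have part: "\<exists>\<I>. finite \<I> \<and> \<I> \<subseteq> ideals Q \<and> \<Union>\<I> = {z \<in> D. \<not> snd Q u z}" if u: "u \<in> D" for u
    proof (rule 1(1))
      show "downset Q {z \<in> D. \<not> snd Q u z}"
        using 1(2) D u unfolding downset_def by (blast intro: qo_trans[OF qo])
      moreover have "{z \<in> D. \<not> snd Q u z} \<subset> D" using u D qo_refl[OF qo] by blast
      ultimately show "({z \<in> D. \<not> snd Q u z}, D) \<in> {(D, E). downset Q D \<and> downset Q E \<and> D \<subset> E}"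
        using 1(2) by blast
    qed
    obtain \<I> \<J> where
      "finite \<I> \<and> \<I> \<subseteq> ideals Q \<and> \<Union>\<I> = {z \<in> D. \<not> snd Q x z}"
      "finite \<J> \<and> \<J> \<subseteq> ideals Q \<and> \<Union>\<J> = {z \<in> D. \<not> snd Q y z}"
      using part xy(1,2) by meson
    then show ?thesis
      using xy(3) by (intro exI[of _ "\<I> \<union> \<J>"]) (auto simp: Union_Un_distrib)
  qed
qed

section \<open>Order embeddings of the poset of ideals\<close>

definition ideal_emb :: "'v qo \<Rightarrow> 'w qo \<Rightarrow> bool" where
  "ideal_emb Q P \<longleftrightarrow> (\<exists>\<phi>. (\<forall>I\<in>ideals Q. \<phi> I \<in> fst P) \<and>
     (\<forall>I\<in>ideals Q. \<forall>J\<in>ideals Q. snd P (\<phi> I) (\<phi> J) \<longleftrightarrow> I \<subseteq> J))"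

text \<open>The relation \<open>L\<close> pairs an ideal with every code arising from some
  presentation of it. Comparing codes for arbitrary presentations avoids reasoning about a chosen
  one; the function is selected only here.\<close>

lemma ideal_embI:
  assumes "\<And>I. I \<in> ideals Q \<Longrightarrow> \<exists>p\<in>fst P. L I p"
    and "\<And>I J p q. L I p \<Longrightarrow> L J q \<Longrightarrow> snd P p q \<longleftrightarrow> I \<subseteq> J"
  shows "ideal_emb Q P"
proof -
  obtain \<phi> where "\<And>I. I \<in> ideals Q \<Longrightarrow> \<phi> I \<in> fst P \<and> L I (\<phi> I)"
    using assms(1) by metis
  then show ?thesis using assms(2) unfolding ideal_emb_def by (intro exI[of _ \<phi>]) blast
qed

lemma ideal_embE:
  assumes "ideal_emb Q P"
  obtains \<phi> where "\<And>I. I \<in> ideals Q \<Longrightarrow> \<phi> I \<in> fst P"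
    "\<And>I J. I \<in> ideals Q \<Longrightarrow> J \<in> ideals Q \<Longrightarrow> snd P (\<phi> I) (\<phi> J) \<longleftrightarrow> I \<subseteq> J"
proof -
  obtain \<phi> where "\<forall>I\<in>ideals Q. \<phi> I \<in> fst P"
    "\<forall>I\<in>ideals Q. \<forall>J\<in>ideals Q. snd P (\<phi> I) (\<phi> J) \<longleftrightarrow> I \<subseteq> J"
    using assms unfolding ideal_emb_def by (elim exE conjE)
  then show thesis by (intro that[of \<phi>]) simp_all
qed

text \<open>Each ideal of \<open>Q\<close> is the preimage of an ideal of \<open>R\<close>, namely
  of the downward closure of its image.\<close>

lemma ideal_emb_wpo_iso:
  assumes iso: "wpo_iso Q R" and "ideal_emb R P"
  shows "ideal_emb Q P"
proof -
  have qo: "quasi_order Q" "quasi_order R" using iso by (auto simp: wpo_iso_def)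
  obtain f where f: "\<And>x. x \<in> fst Q \<Longrightarrow> f x \<in> fst R"
    "\<And>x y. x \<in> fst Q \<Longrightarrow> y \<in> fst Q \<Longrightarrow> snd R (f x) (f y) \<longleftrightarrow> snd Q x y"
    "\<And>y. y \<in> fst R \<Longrightarrow> \<exists>x\<in>fst Q. snd R (f x) y \<and> snd R y (f x)"
    using iso by (rule wpo_iso_map) blast
  obtain \<phi> where \<phi>: "\<And>I. I \<in> ideals R \<Longrightarrow> \<phi> I \<in> fst P"
    "\<And>I J. I \<in> ideals R \<Longrightarrow> J \<in> ideals R \<Longrightarrow> snd P (\<phi> I) (\<phi> J) \<longleftrightarrow> I \<subseteq> J"
    using assms(2) by (rule ideal_embE) blast
  define pre where "pre J = {x \<in> fst Q. f x \<in> J}" for J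
  show ?thesis
  proof (rule ideal_embI[where L = "\<lambda>I p. \<exists>J\<in>ideals R. I = pre J \<and> p = \<phi> J"])
    fix I assume I: "I \<in> ideals Q"
    have IQ: "I \<subseteq> fst Q" by (rule idealsD(3)[OF I])
    define J where "J = {y \<in> fst R. \<exists>x\<in>I. snd R y (f x)}"
    have fI: "f x \<in> J" if "x \<in> I" for x
      using that IQ f(1) qo_refl[OF qo(2)] by (auto simp: J_def)
    have "J \<in> ideals R"
    proof (rule idealsI)
      show "downset R J"
        unfolding downset_def
      proof (intro conjI ballI impI)
        fix y z assume "y \<in> J" "z \<in> fst R" "snd R z y"
        then obtain x where "x \<in> I" "snd R y (f x)" "y \<in> fst R" by (auto simp: J_def)
        with \<open>z \<in> fst R\<close> \<open>snd R z y\<close> have "snd R z (f x)"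
          using qo_trans[OF qo(2)] f(1) IQ by blast
        with \<open>x \<in> I\<close> \<open>z \<in> fst R\<close> show "z \<in> J" by (auto simp: J_def)
      qed (auto simp: J_def)
      show "J \<noteq> {}" using idealsD(2)[OF I] fI by blast
      fix y z assume "y \<in> J" "z \<in> J"
      then obtain a b where ab: "a \<in> I" "b \<in> I" "snd R y (f a)" "snd R z (f b)" "y \<in> fst R" "z \<in> fst R"
        by (auto simp: J_def)
      obtain c where c: "c \<in> I" "snd Q a c" "snd Q b c" using idealsD(4)[OF I ab(1,2)] by blast
      then have "snd R (f a) (f c)" "snd R (f b) (f c)" using f(2) ab IQ by (auto simp: subset_eq)
      then have "snd R y (f c)" "snd R z (f c)"
        using ab c(1) IQ f(1) qo_trans[OF qo(2)] by blast+
      with fI[OF c(1)] show "\<exists>u\<in>J. snd R y u \<and> snd R z u" by blast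
    qed
    moreover have "I = pre J"
    proof
      show "I \<subseteq> pre J" using fI IQ by (auto simp: pre_def)
      show "pre J \<subseteq> I"
      proof
        fix x assume "x \<in> pre J"
        then obtain y where "x \<in> fst Q" "y \<in> I" "snd R (f x) (f y)" by (auto simp: pre_def J_def)
        then show "x \<in> I" using f(2) IQ downsetD[OF idealsD(1)[OF I]] by blast
      qed
    qed
    ultimately show "\<exists>p\<in>fst P. \<exists>J\<in>ideals R. I = pre J \<and> p = \<phi> J" using \<phi>(1) by blast
  next
    fix I I' p q assume "\<exists>J\<in>ideals R. I = pre J \<and> p = \<phi> J" "\<exists>J\<in>ideals R. I' = pre J \<and> q = \<phi> J"
    then obtain J J' where J: "J \<in> ideals R" "I = pre J" "p = \<phi> J" "J' \<in> ideals R" "I' = pre J'" "q = \<phi> J'"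
      by blast
    \<comment> \<open>Inclusion of preimages lifts back to \<open>R\<close> because every
      \<open>y\<close> in \<open>R\<close> is equivalent to some \<open>f x\<close>.\<close>
    have "J \<subseteq> J'" if sub: "pre J \<subseteq> pre J'"
    proof
      fix y assume y: "y \<in> J"
      then have yR: "y \<in> fst R" using idealsD(3)[OF J(1)] by blast
      then obtain x where x: "x \<in> fst Q" "snd R (f x) y" "snd R y (f x)" using f(3) by blast
      then have "f x \<in> J" using downsetD[OF idealsD(1)[OF J(1)] y] f(1) by blast
      then have "f x \<in> J'" using sub x(1) by (auto simp: pre_def)
      then show "y \<in> J'" using downsetD[OF idealsD(1)[OF J(4)]] yR x(3) by blast
    qed
    moreover have "pre J \<subseteq> pre J'" if "J \<subseteq> J'" using that by (auto simp: pre_def)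
    ultimately show "snd P p q \<longleftrightarrow> I \<subseteq> I'" using J \<phi>(2)[OF J(1,4)] by simp metis
  qed
qed

section \<open>Ideals of ordinals, sums and products\<close>

lemma Well_orderD:
  assumes "Well_order r"
  shows "x \<in> Field r \<Longrightarrow> (x, x) \<in> r"
    and "(x, y) \<in> r \<Longrightarrow> (y, z) \<in> r \<Longrightarrow> (x, z) \<in> r"
    and "(x, y) \<in> r \<Longrightarrow> (y, x) \<in> r \<Longrightarrow> x = y"
    and "x \<in> Field r \<Longrightarrow> y \<in> Field r \<Longrightarrow> (x, y) \<in> r \<or> (y, x) \<in> r"
proof -
  have *: "refl_on (Field r) r" "trans r" "antisym r" "total_on (Field r) r"
    using assms
    by (auto simp: well_order_on_def linear_order_on_def partial_order_on_def preorder_on_def)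
  show "x \<in> Field r \<Longrightarrow> (x, x) \<in> r"
    using *(1) by (rule refl_onD)
  show "(x, y) \<in> r \<Longrightarrow> (y, z) \<in> r \<Longrightarrow> (x, z) \<in> r"
    using *(2) by (rule transD)
  show "(x, y) \<in> r \<Longrightarrow> (y, x) \<in> r \<Longrightarrow> x = y"
    using *(3) by (rule antisymD)
  show "x \<in> Field r \<Longrightarrow> y \<in> Field r \<Longrightarrow> (x, y) \<in> r \<or> (y, x) \<in> r"
    using *(1,4) by (metis refl_onD total_on_def)
qed

lemma Field_seg: "Well_order r \<Longrightarrow> Field (seg r a) = underS r a"
  using Well_orderD(1)[of r] by (auto simp: seg_def Field_def underS_def)

text \<open>An ideal of the segment is an initial segment of \<open>r\<close> omitting
  \<open>a\<close>, hence the strict segment below some \<open>b\<close>, which serves as its code.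
  The full segment is sent to \<open>a\<close> itself, a point still available in
  \<open>r\<close>.\<close>

lemma ideal_emb_qord_seg:
  assumes r: "Well_order r" and a: "a \<in> Field r"
  shows "ideal_emb (qord (seg r a)) (qord r)"
proof (rule ideal_embI[where L = "\<lambda>I p. \<exists>b\<in>Field r. I = Atm ` underS r b \<and> p = Atm b"])
  fix I assume I: "I \<in> ideals (qord (seg r a))"
  define S where "S = {x. Atm x \<in> I}"
  have IS: "I = Atm ` S" "S \<subseteq> underS r a"
    using idealsD(3)[OF I] by (auto simp: S_def Field_seg[OF r])
  have "wo_rel.ofilter r S"
    unfolding wo_rel.ofilter_def[OF wo_rel.intro[OF r]]
  proof (intro conjI ballI subsetI)
    show "x \<in> Field r" if "x \<in> S" for x
      using that IS(2) by (auto simp: underS_def Field_def)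
    show "y \<in> S" if "x \<in> S" "y \<in> under r x" for x y
    proof -
      have yx: "(y, x) \<in> r" "x \<in> underS r a" using that IS(2) by (auto simp: under_def)
      then have "y \<in> underS r a"
        using Well_orderD(2,3)[OF r] by (auto simp: underS_def)
      then show ?thesis
        using yx that(1) downsetD[OF idealsD(1)[OF I], of "Atm x" "Atm y"]
        by (auto simp: S_def Field_seg[OF r]) (simp add: seg_def)
    qed
  qed
  moreover have "S \<noteq> Field r" using IS(2) a by (auto simp: underS_def)
  ultimately obtain b where "b \<in> Field r" "S = underS r b"
    by (auto simp: wo_rel.ofilter_underS_Field[OF wo_rel.intro[OF r]])
  then show "\<exists>p\<in>fst (qord r). \<exists>b\<in>Field r. I = Atm ` underS r b \<and> p = Atm b"
    using IS(1) by auto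
next
  fix I J p q assume "\<exists>b\<in>Field r. I = Atm ` underS r b \<and> p = Atm b"
    "\<exists>b\<in>Field r. J = Atm ` underS r b \<and> q = Atm b"
  then obtain b c where bc: "b \<in> Field r" "I = Atm ` underS r b" "p = Atm b"
      "c \<in> Field r" "J = Atm ` underS r c" "q = Atm c" by blast
  have "I \<subseteq> J \<longleftrightarrow> underS r b \<subseteq> underS r c" using bc by auto
  also have "\<dots> \<longleftrightarrow> (b, c) \<in> r"
    using r bc by (simp add: underS_incl_iff well_order_on_def)
  finally show "snd (qord r) p q \<longleftrightarrow> I \<subseteq> J" using bc by simp
qed

text \<open>Elements of different summands have no common upper bound, so a directed set stays in
  one summand.\<close>

lemma ideal_qsum_cases:
  assumes I: "I \<in> ideals (qsum Q R)"
  shows "(\<exists>J\<in>ideals Q. I = InL ` J) \<or> (\<exists>J\<in>ideals R. I = InR ` J)"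
proof -
  note D = downsetD[OF idealsD(1)[OF I]] and ub = idealsD(4)[OF I] and sub = idealsD(3)[OF I]
  show ?thesis
  proof (cases "\<exists>x. InL x \<in> I")
    case True
    then obtain x where x: "InL x \<in> I" by blast
    have "z \<in> range InL" if "z \<in> I" for z
      using ub[OF x that] subsetD[OF sub that] sub by auto
    then have eq: "I = InL ` {y. InL y \<in> I}" by auto
    moreover have "{y. InL y \<in> I} \<in> ideals Q"
    proof (rule idealsI)
      show "downset Q {y. InL y \<in> I}" using sub D by (auto simp: downset_def)
      show "\<exists>z\<in>{y. InL y \<in> I}. snd Q u z \<and> snd Q v z" if uv: "u \<in> {y. InL y \<in> I}" "v \<in> {y. InL y \<in> I}" for u v
      proof -
        obtain z where z: "z \<in> I" "snd (qsum Q R) (InL u) z" "snd (qsum Q R) (InL v) z"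
          using ub[of "InL u" "InL v"] uv by blast
        obtain w where "z = InL w" using z(1) eq by blast
        with z show ?thesis by auto
      qed
    qed (use x in blast)
    ultimately show ?thesis by blast
  next
    case False
    then have eq: "I = InR ` {y. InR y \<in> I}" using sub by auto
    moreover have "{y. InR y \<in> I} \<in> ideals R"
    proof (rule idealsI)
      show "downset R {y. InR y \<in> I}" using sub D by (auto simp: downset_def)
      show "\<exists>z\<in>{y. InR y \<in> I}. snd R u z \<and> snd R v z" if uv: "u \<in> {y. InR y \<in> I}" "v \<in> {y. InR y \<in> I}" for u v
      proof -
        obtain z where z: "z \<in> I" "snd (qsum Q R) (InR u) z" "snd (qsum Q R) (InR v) z"
          using ub[of "InR u" "InR v"] uv by blast
        obtain w where "z = InR w" using z(1) eq by blast
        with z show ?thesis by auto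
      qed
      show "{y. InR y \<in> I} \<noteq> {}" using idealsD(2)[OF I] eq by blast
    qed
    ultimately show ?thesis by blast
  qed
qed

lemma ideal_emb_qsum:
  assumes "ideal_emb Q P" "ideal_emb R S"
  shows "ideal_emb (qsum Q R) (qsum P S)"
proof -
  obtain \<phi> where \<phi>: "\<And>I. I \<in> ideals Q \<Longrightarrow> \<phi> I \<in> fst P"
    "\<And>I J. I \<in> ideals Q \<Longrightarrow> J \<in> ideals Q \<Longrightarrow> snd P (\<phi> I) (\<phi> J) \<longleftrightarrow> I \<subseteq> J"
    using assms(1) by (rule ideal_embE) blast
  obtain \<psi> where \<psi>: "\<And>I. I \<in> ideals R \<Longrightarrow> \<psi> I \<in> fst S"
    "\<And>I J. I \<in> ideals R \<Longrightarrow> J \<in> ideals R \<Longrightarrow> snd S (\<psi> I) (\<psi> J) \<longleftrightarrow> I \<subseteq> J"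
    using assms(2) by (rule ideal_embE) blast
  let ?L = "\<lambda>I p. (\<exists>J\<in>ideals Q. I = InL ` J \<and> p = InL (\<phi> J)) \<or> (\<exists>J\<in>ideals R. I = InR ` J \<and> p = InR (\<psi> J))"
  show ?thesis
  proof (rule ideal_embI[where L = ?L])
    show "\<exists>p\<in>fst (qsum P S). ?L I p" if I: "I \<in> ideals (qsum Q R)" for I
    proof -
      consider J where "J \<in> ideals Q" "I = InL ` J" | J where "J \<in> ideals R" "I = InR ` J"
        using ideal_qsum_cases[OF I] by blast
      then show ?thesis
      proof cases
        case 1
        then show ?thesis using \<phi>(1) by (intro bexI[of _ "InL (\<phi> J)"]) auto
      next
        case 2
        then show ?thesis using \<psi>(1) by (intro bexI[of _ "InR (\<psi> J)"]) auto
      qed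
    qed
    show "snd (qsum P S) p q \<longleftrightarrow> I \<subseteq> J" if "?L I p" "?L J q" for I J p q
    proof -
      have disj: "\<not> InL ` A \<subseteq> InR ` B" "\<not> InR ` A \<subseteq> InL ` B" if "A \<noteq> {}" for A B :: "'a val set"
        using that by auto
      have sub: "InL ` A \<subseteq> InL ` B \<longleftrightarrow> A \<subseteq> B" "InR ` A \<subseteq> InR ` B \<longleftrightarrow> A \<subseteq> B" for A B :: "'a val set"
        by auto
      from that show ?thesis
        using \<phi>(2) \<psi>(2) by (elim disjE bexE conjE) (simp_all add: disj sub idealsD(2))
    qed
  qed
qed

text \<open>An upper bound in \<open>I\<close> of \<open>Pr a b\<close> and \<open>Pr c d\<close>
  also dominates \<open>Pr a d\<close>; hence \<open>I\<close> is the full rectangle over its two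
  projections.\<close>

lemma ideal_qprod:
  assumes qo: "quasi_order Q" "quasi_order R" and I: "I \<in> ideals (qprod Q R)"
  shows "\<exists>J\<in>ideals Q. \<exists>K\<in>ideals R. I = {Pr a b | a b. a \<in> J \<and> b \<in> K}"
proof -
  note D = downsetD[OF idealsD(1)[OF I]] and ub = idealsD(4)[OF I] and sub = idealsD(3)[OF I]
  define J where "J = {a. \<exists>b. Pr a b \<in> I}"
  define K where "K = {b. \<exists>a. Pr a b \<in> I}"
  have mem: "a \<in> fst Q \<and> b \<in> fst R" if "Pr a b \<in> I" for a b using that sub by auto
  have isPr: "\<exists>a b. z = Pr a b" if "z \<in> I" for z using that sub by (auto simp: fst_qprod)
  have ub': "\<exists>e f. Pr e f \<in> I \<and> snd Q a e \<and> snd Q c e \<and> snd R b f \<and> snd R d f"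
    if "Pr a b \<in> I" "Pr c d \<in> I" for a b c d
    using ub[OF that] isPr by fastforce
  have D': "Pr c d \<in> I" if "Pr a b \<in> I" "c \<in> fst Q" "d \<in> fst R" "snd Q c a" "snd R d b" for a b c d
    using D[OF that(1), of "Pr c d"] that by simp
  have ne: "\<exists>a b. Pr a b \<in> I" using idealsD(2)[OF I] isPr by blast
  have "J \<in> ideals Q"
  proof (rule idealsI)
    show "downset Q J"
      unfolding downset_def
    proof (intro conjI ballI impI)
      show "J \<subseteq> fst Q" using mem by (auto simp: J_def)
      fix a c assume "a \<in> J" "c \<in> fst Q" "snd Q c a"
      then obtain b where "Pr a b \<in> I" by (auto simp: J_def)
      then have "Pr c b \<in> I"
        using D'[of a b c b] mem qo_refl[OF qo(2)] \<open>c \<in> fst Q\<close> \<open>snd Q c a\<close> by blast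
      then show "c \<in> J" by (auto simp: J_def)
    qed
    show "J \<noteq> {}" using ne by (auto simp: J_def)
    show "\<exists>z\<in>J. snd Q x z \<and> snd Q y z" if "x \<in> J" "y \<in> J" for x y
      using that ub' unfolding J_def by blast
  qed
  moreover have "K \<in> ideals R"
  proof (rule idealsI)
    show "downset R K"
      unfolding downset_def
    proof (intro conjI ballI impI)
      show "K \<subseteq> fst R" using mem by (auto simp: K_def)
      fix b d assume "b \<in> K" "d \<in> fst R" "snd R d b"
      then obtain a where "Pr a b \<in> I" by (auto simp: K_def)
      then have "Pr a d \<in> I"
        using D'[of a b a d] mem qo_refl[OF qo(1)] \<open>d \<in> fst R\<close> \<open>snd R d b\<close> by blast
      then show "d \<in> K" by (auto simp: K_def)
    qed
    show "K \<noteq> {}" using ne by (auto simp: K_def)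
    show "\<exists>z\<in>K. snd R x z \<and> snd R y z" if "x \<in> K" "y \<in> K" for x y
      using that ub' unfolding K_def by blast
  qed
  moreover have "I = {Pr a b | a b. a \<in> J \<and> b \<in> K}"
  proof
    show "I \<subseteq> {Pr a b | a b. a \<in> J \<and> b \<in> K}" using isPr by (fastforce simp: J_def K_def)
    show "{Pr a b | a b. a \<in> J \<and> b \<in> K} \<subseteq> I"
    proof clarify
      fix a d assume "a \<in> J" "d \<in> K"
      then obtain b c where "Pr a b \<in> I" "Pr c d \<in> I" by (auto simp: J_def K_def)
      with ub'[OF this] show "Pr a d \<in> I" using D' mem by blast
    qed
  qed
  ultimately show ?thesis by blast
qed

lemma ideal_emb_qprod:
  assumes qo: "quasi_order Q" "quasi_order R" and "ideal_emb Q P" "ideal_emb R S"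
  shows "ideal_emb (qprod Q R) (qprod P S)"
proof -
  obtain \<phi> where \<phi>: "\<And>I. I \<in> ideals Q \<Longrightarrow> \<phi> I \<in> fst P"
    "\<And>I J. I \<in> ideals Q \<Longrightarrow> J \<in> ideals Q \<Longrightarrow> snd P (\<phi> I) (\<phi> J) \<longleftrightarrow> I \<subseteq> J"
    using assms(3) by (rule ideal_embE) blast
  obtain \<psi> where \<psi>: "\<And>I. I \<in> ideals R \<Longrightarrow> \<psi> I \<in> fst S"
    "\<And>I J. I \<in> ideals R \<Longrightarrow> J \<in> ideals R \<Longrightarrow> snd S (\<psi> I) (\<psi> J) \<longleftrightarrow> I \<subseteq> J"
    using assms(4) by (rule ideal_embE) blast
  let ?L = "\<lambda>I p. \<exists>J\<in>ideals Q. \<exists>K\<in>ideals R. I = {Pr a b | a b. a \<in> J \<and> b \<in> K} \<and> p = Pr (\<phi> J) (\<psi> K)"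
  show ?thesis
  proof (rule ideal_embI[where L = ?L])
    show "\<exists>p\<in>fst (qprod P S). ?L I p" if I: "I \<in> ideals (qprod Q R)" for I
    proof -
      obtain J K where "J \<in> ideals Q" "K \<in> ideals R" "I = {Pr a b | a b. a \<in> J \<and> b \<in> K}"
        using ideal_qprod[OF qo I] by blast
      then show ?thesis
        using \<phi>(1) \<psi>(1) by (intro bexI[of _ "Pr (\<phi> J) (\<psi> K)"] bexI[of _ J] bexI[of _ K] conjI) auto
    qed
    show "snd (qprod P S) p q \<longleftrightarrow> I \<subseteq> I'" if L: "?L I p" "?L I' q" for I I' p q
    proof -
      obtain J K where 1: "J \<in> ideals Q" "K \<in> ideals R" "I = {Pr a b | a b. a \<in> J \<and> b \<in> K}"
        "p = Pr (\<phi> J) (\<psi> K)" using L(1) by blast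
      obtain J' K' where 2: "J' \<in> ideals Q" "K' \<in> ideals R" "I' = {Pr a b | a b. a \<in> J' \<and> b \<in> K'}"
        "q = Pr (\<phi> J') (\<psi> K')" using L(2) by blast
      have "I \<subseteq> I' \<longleftrightarrow> J \<subseteq> J' \<and> K \<subseteq> K'"
        using idealsD(2)[OF 1(1)] idealsD(2)[OF 1(2)] by (auto simp: 1(3) 2(3))
      then show ?thesis using 1 2 \<phi>(2) \<psi>(2) by simp
    qed
  qed
qed

section \<open>Ideals of finite powers as boxes\<close>

definition box :: "'v set list \<Rightarrow> 'v list set" where
  "box Is = {xs. list_all2 (\<in>) xs Is}"

lemma box_iff: "xs \<in> box Is \<longleftrightarrow> length xs = length Is \<and> (\<forall>i<length Is. xs ! i \<in> Is ! i)"
  by (auto simp: box_def list_all2_conv_all_nth)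

lemma box_nonempty:
  assumes "\<forall>I\<in>set Is. I \<noteq> {}"
  shows "box Is \<noteq> {}"
proof -
  have "map (\<lambda>I. SOME x. x \<in> I) Is \<in> box Is"
    using assms by (auto simp: box_iff some_in_eq)
  then show ?thesis by blast
qed

lemma box_subset_iff:
  assumes "\<forall>I\<in>set Is. I \<noteq> {}" "length Is = length Js"
  shows "box Is \<subseteq> box Js \<longleftrightarrow> list_all2 (\<subseteq>) Is Js"
proof
  assume sub: "box Is \<subseteq> box Js"
  obtain b where b: "b \<in> box Is" using box_nonempty[OF assms(1)] by blast
  have "x \<in> Js ! i" if i: "i < length Is" "x \<in> Is ! i" for i x
  proof -
    \<comment> \<open>Changing one coordinate of a fixed member of the box isolates the inclusion at
      that coordinate; this is where nonemptiness of all factors is used.\<close>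
    have "b[i := x] \<in> box Is" using b i by (auto simp: box_iff nth_list_update)
    then have "b[i := x] \<in> box Js" using sub by blast
    then show ?thesis using i b assms(2) by (auto simp: box_iff dest!: spec[of _ i])
  qed
  then show "list_all2 (\<subseteq>) Is Js" using assms(2) by (auto simp: list_all2_conv_all_nth)
qed (auto simp: box_iff list_all2_conv_all_nth subset_iff)

lemma Wd_box_ideal:
  assumes "set Is \<subseteq> ideals Q"
  shows "Wd ` box Is \<in> ideals (qpow (length Is) Q)"
proof (rule idealsI)
  have Is: "Is ! i \<in> ideals Q" if "i < length Is" for i using assms that by auto
  show "Wd ` box Is \<noteq> {}"
    using box_nonempty[of Is] assms idealsD(2) by blast
  show "downset (qpow (length Is) Q) (Wd ` box Is)"
    unfolding downset_def
  proof (intro conjI ballI impI)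
    show "Wd ` box Is \<subseteq> fst (qpow (length Is) Q)"
      using idealsD(3)[OF Is] by (auto simp: box_iff in_set_conv_nth subset_iff)
  next
    fix x y assume "x \<in> Wd ` box Is" "y \<in> fst (qpow (length Is) Q)" "snd (qpow (length Is) Q) y x"
    then obtain xs ys where *: "x = Wd xs" "xs \<in> box Is" "y = Wd ys" "set ys \<subseteq> fst Q"
      "length ys = length Is" "list_all2 (snd Q) ys xs"
      by (auto simp: fst_qpow)
    have "ys ! i \<in> Is ! i" if "i < length Is" for i
    proof (rule downsetD[OF idealsD(1)[OF Is[OF that]]])
      show "xs ! i \<in> Is ! i" using * that by (simp add: box_iff)
      show "ys ! i \<in> fst Q" using * that by (metis nth_mem subsetD)
      show "snd Q (ys ! i) (xs ! i)" using * that by (simp add: list_all2_conv_all_nth)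
    qed
    then show "y \<in> Wd ` box Is" using * by (auto simp: box_iff)
  qed
  fix x y assume "x \<in> Wd ` box Is" "y \<in> Wd ` box Is"
  then obtain xs ys where *: "x = Wd xs" "xs \<in> box Is" "y = Wd ys" "ys \<in> box Is" by blast
  have "\<forall>i<length Is. \<exists>z\<in>Is ! i. snd Q (xs ! i) z \<and> snd Q (ys ! i) z"
    using * idealsD(4)[OF Is] by (auto simp: box_iff)
  then obtain z where z: "\<And>i. i < length Is \<Longrightarrow> z i \<in> Is ! i \<and> snd Q (xs ! i) (z i) \<and> snd Q (ys ! i) (z i)"
    by metis
  define zs where "zs = map z [0..<length Is]"
  have "zs \<in> box Is" "list_all2 (snd Q) xs zs" "list_all2 (snd Q) ys zs"
    using z * by (auto simp: zs_def box_iff list_all2_conv_all_nth)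
  then show "\<exists>z\<in>Wd ` box Is. snd (qpow (length Is) Q) x z \<and> snd (qpow (length Is) Q) y z"
    using * by auto
qed

text \<open>Directedness merges finitely many words of \<open>I\<close>, one realising each
  prescribed letter, into a single word of \<open>I\<close> that dominates the prescribed
  word.\<close>

lemma ideal_qpow:
  assumes qo: "quasi_order Q" and I: "I \<in> ideals (qpow n Q)"
  shows "\<exists>Is. set Is \<subseteq> ideals Q \<and> length Is = n \<and> I = Wd ` box Is"
proof -
  note D = downsetD[OF idealsD(1)[OF I]] and ub = idealsD(4)[OF I] and sub = idealsD(3)[OF I]
  have isWd: "\<exists>xs. w = Wd xs \<and> length xs = n \<and> set xs \<subseteq> fst Q" if "w \<in> I" for w
    using that sub by (auto simp: fst_qpow)
  define pj where "pj i = {xs ! i | xs. Wd xs \<in> I}" for i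
  have pj: "pj i \<in> ideals Q" if i: "i < n" for i
  proof (rule idealsI)
    show "pj i \<noteq> {}" using idealsD(2)[OF I] isWd by (fastforce simp: pj_def)
    show "downset Q (pj i)"
      unfolding downset_def
    proof (intro conjI ballI impI)
      show "pj i \<subseteq> fst Q" using isWd i by (fastforce simp: pj_def)
      fix x y assume "x \<in> pj i" and y: "y \<in> fst Q" "snd Q y x"
      then obtain xs where xs: "Wd xs \<in> I" "x = xs ! i" by (auto simp: pj_def)
      then have xs': "length xs = n" "set xs \<subseteq> fst Q" using isWd by auto
      have "Wd (xs[i := y]) \<in> I"
      proof (rule D[OF xs(1)])
        show "Wd (xs[i := y]) \<in> fst (qpow n Q)"
          using xs' y(1) set_update_subset_insert[of xs i y] by auto
        show "snd (qpow n Q) (Wd (xs[i := y])) (Wd xs)"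
          using xs xs' y i
          by (auto simp: list_all2_conv_all_nth nth_list_update intro!: qo_refl[OF qo] dest!: nth_mem)
      qed
      then show "y \<in> pj i" using i xs' unfolding pj_def
        by (intro CollectI exI[of _ "xs[i := y]"]) auto
    qed
    fix x y assume "x \<in> pj i" "y \<in> pj i"
    then obtain xs ys where xs: "Wd xs \<in> I" "x = xs ! i" "Wd ys \<in> I" "y = ys ! i"
      by (auto simp: pj_def)
    obtain w where w: "w \<in> I" "snd (qpow n Q) (Wd xs) w" "snd (qpow n Q) (Wd ys) w"
      using ub[OF xs(1,3)] by blast
    obtain zs where "w = Wd zs" "length zs = n" using isWd[OF w(1)] by blast
    then show "\<exists>z\<in>pj i. snd Q x z \<and> snd Q y z"
      using w xs i unfolding pj_def by (intro bexI[of _ "zs ! i"]) (auto simp: list_all2_conv_all_nth)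
  qed
  have "I = Wd ` box (map pj [0..<n])"
  proof
    show "I \<subseteq> Wd ` box (map pj [0..<n])"
    proof
      fix w assume w: "w \<in> I"
      obtain xs where "w = Wd xs" "length xs = n" using isWd[OF w] by blast
      moreover from this have "xs \<in> box (map pj [0..<n])" using w by (auto simp: box_iff pj_def)
      ultimately show "w \<in> Wd ` box (map pj [0..<n])" by blast
    qed
    show "Wd ` box (map pj [0..<n]) \<subseteq> I"
    proof clarify
      fix ys assume ys: "ys \<in> box (map pj [0..<n])"
      then have ys': "length ys = n" "\<And>i. i < n \<Longrightarrow> ys ! i \<in> pj i" by (auto simp: box_iff)
      then have "\<forall>i<n. \<exists>xs. Wd xs \<in> I \<and> ys ! i = xs ! i" by (auto simp: pj_def)
      then obtain X where X: "\<And>i. i < n \<Longrightarrow> Wd (X i) \<in> I \<and> ys ! i = X i ! i" by metis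
      obtain w where w: "w \<in> I" "\<forall>v\<in>(\<lambda>i. Wd (X i)) ` {..<n}. snd (qpow n Q) v w"
        using ideal_finite_ub[OF quasi_order_qpow[OF qo] I, of "(\<lambda>i. Wd (X i)) ` {..<n}"] X by blast
      obtain zs where zs: "w = Wd zs" "length zs = n" using isWd[OF w(1)] by blast
      have "list_all2 (snd Q) ys zs"
        using w(2) X zs ys'(1) by (fastforce simp: list_all2_conv_all_nth)
      moreover have "set ys \<subseteq> fst Q"
        using ys' idealsD(3)[OF pj] by (fastforce simp: in_set_conv_nth)
      ultimately show "Wd ys \<in> I" using D[OF w(1), of "Wd ys"] zs ys'(1) by auto
    qed
  qed
  then show ?thesis using pj by (intro exI[of _ "map pj [0..<n]"]) auto
qed

text \<open>An embedding between words of equal length can skip no letter.\<close>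

lemma list_emb_same_length_iff:
  "length xs = length ys \<Longrightarrow> list_emb P xs ys \<longleftrightarrow> list_all2 P xs ys"
proof
  show "list_emb P xs ys \<Longrightarrow> length xs = length ys \<Longrightarrow> list_all2 P xs ys"
    by (induction rule: list_emb.induct) (auto dest: list_emb_length)
  show "list_all2 P xs ys \<Longrightarrow> length xs = length ys \<Longrightarrow> list_emb P xs ys"
    by (induction rule: list_all2_induct) auto
qed

text \<open>All codes have length \<open>n\<close>, and on words of one length the subword order of
  \<open>qstar P\<close> is componentwise, which is how boxes are compared.\<close>

lemma ideal_emb_qpow:
  assumes qo: "quasi_order Q" and "ideal_emb Q P"
  shows "ideal_emb (qpow n Q) (qstar P)"
proof -
  obtain \<phi> where \<phi>: "\<And>I. I \<in> ideals Q \<Longrightarrow> \<phi> I \<in> fst P"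
    "\<And>I J. I \<in> ideals Q \<Longrightarrow> J \<in> ideals Q \<Longrightarrow> snd P (\<phi> I) (\<phi> J) \<longleftrightarrow> I \<subseteq> J"
    using assms(2) by (rule ideal_embE) blast
  let ?L = "\<lambda>I p. \<exists>Is. set Is \<subseteq> ideals Q \<and> length Is = n \<and> I = Wd ` box Is \<and> p = Wd (map \<phi> Is)"
  show ?thesis
  proof (rule ideal_embI[where L = ?L])
    fix I assume "I \<in> ideals (qpow n Q)"
    then obtain Is where "set Is \<subseteq> ideals Q" "length Is = n" "I = Wd ` box Is"
      using ideal_qpow[OF qo] by blast
    then show "\<exists>p\<in>fst (qstar P). ?L I p"
      using \<phi>(1) by (intro bexI[of _ "Wd (map \<phi> Is)"]) auto
  next
    fix I J p q assume "?L I p" "?L J q"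
    then obtain Is Js where *: "set Is \<subseteq> ideals Q" "length Is = n" "I = Wd ` box Is" "p = Wd (map \<phi> Is)"
      "set Js \<subseteq> ideals Q" "length Js = n" "J = Wd ` box Js" "q = Wd (map \<phi> Js)" by blast
    have "I \<subseteq> J \<longleftrightarrow> box Is \<subseteq> box Js" using * by auto
    also have "\<dots> \<longleftrightarrow> list_all2 (\<subseteq>) Is Js"
    proof (rule box_subset_iff)
      show "\<forall>I\<in>set Is. I \<noteq> {}" using *(1) idealsD(2) by blast
    qed (use * in simp)
    also have "\<dots> \<longleftrightarrow> list_all2 (\<lambda>I J. snd P (\<phi> I) (\<phi> J)) Is Js"
      using * \<phi>(2) by (auto simp: list_all2_conv_all_nth subset_eq)
    finally show "snd (qstar P) p q \<longleftrightarrow> I \<subseteq> J"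
      using * by (simp add: list_emb_same_length_iff list_all2_map1 list_all2_map2)
  qed
qed

section \<open>Ideals of multisets of fixed size\<close>

lemma rel_mset_mset_iff:
  "rel_mset R (mset xs) (mset ys) \<longleftrightarrow> (\<exists>ys'. mset ys' = mset ys \<and> list_all2 R xs ys')"
  unfolding rel_mset_def by (metis list_all2_reorder_left_invariance)

lemma box_reorder_left:
  "xs \<in> box Is \<Longrightarrow> mset ys = mset xs \<Longrightarrow> \<exists>Js. ys \<in> box Js \<and> mset Js = mset Is"
  unfolding box_def using list_all2_reorder_left_invariance by blast

lemma box_reorder_right:
  assumes "xs \<in> box Is" "mset Js = mset Is"
  shows "\<exists>ys. ys \<in> box Js \<and> mset ys = mset xs"
proof -
  have "list_all2 (\<lambda>I x. x \<in> I) Is xs"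
    using assms(1) by (simp add: box_def list_all2_conv_all_nth)
  from list_all2_reorder_left_invariance[OF this assms(2)]
  obtain ys where "list_all2 (\<lambda>I x. x \<in> I) Js ys" "mset ys = mset xs" by blast
  then show ?thesis by (auto simp: box_def list_all2_conv_all_nth)
qed

abbreviation msbox :: "'a val set list \<Rightarrow> 'a val set" where
  "msbox Is \<equiv> (\<lambda>xs. MS (mset xs)) ` box Is"

text \<open>A listing of a smaller multiset is a word below some reordering of \<open>xs\<close>.
  That reordering lies in the box of a permutation of \<open>Is\<close>, which is a downset of the
  power; permuting back returns to \<open>Is\<close>.\<close>

lemma downset_msbox:
  assumes "set Is \<subseteq> ideals Q"
  shows "downset (qmsn (length Is) Q) (msbox Is)"
  unfolding downset_def
proof (intro conjI ballI impI)
  have ideal: "Wd ` box Is \<in> ideals (qpow (length Is) Q)" by (rule Wd_box_ideal[OF assms])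
  have in_qpow: "set xs \<subseteq> fst Q" "length xs = length Is" if "xs \<in> box Is" for xs
    using subsetD[OF idealsD(3)[OF ideal] imageI[OF that]] by auto
  then show "msbox Is \<subseteq> fst (qmsn (length Is) Q)" by auto
  fix x y assume "x \<in> msbox Is" "y \<in> fst (qmsn (length Is) Q)" "snd (qmsn (length Is) Q) y x"
  then obtain xs m where *: "xs \<in> box Is" "x = MS (mset xs)" "y = MS m" "set_mset m \<subseteq> fst Q"
    "size m = length Is" "mset_emb (snd Q) m (mset xs)"
    by (auto simp: fst_qmsn)
  obtain ys where ys: "mset ys = m" using ex_mset by blast
  have "rel_mset (snd Q) (mset ys) (mset xs)"
    using * ys in_qpow(2)[OF *(1)] mset_emb_same_size[of m "mset xs"] by simp
  then obtain xs' where xs': "mset xs' = mset xs" "list_all2 (snd Q) ys xs'"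
    by (auto simp: rel_mset_mset_iff)
  obtain Js where Js: "xs' \<in> box Js" "mset Js = mset Is"
    using box_reorder_left[OF *(1) xs'(1)] by blast
  have len: "length Js = length Is" "set Js = set Is"
    using Js(2) by (metis size_mset, metis set_mset_mset)
  have "Wd ` box Js \<in> ideals (qpow (length Is) Q)"
    using Wd_box_ideal[of Js Q] assms len by simp
  from downsetD[OF idealsD(1)[OF this], of "Wd xs'" "Wd ys"] have "ys \<in> box Js"
    using Js(1) xs'(2) * ys by auto
  then show "y \<in> msbox Is"
    using box_reorder_right[of ys Js Is] Js(2) *(3) ys by (metis image_eqI)
qed

text \<open>Inclusion only says that each word over \<open>Is\<close> fits some permutation of
  \<open>Js\<close>, possibly a different one for each word. The box of \<open>Is\<close> is thus
  covered by finitely many boxes, and primality selects one permutation for all words: the desired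
  matching.\<close>

lemma msbox_subset_iff:
  assumes qo: "quasi_order Q" and Is: "set Is \<subseteq> ideals Q" "set Js \<subseteq> ideals Q" "length Is = length Js"
  shows "msbox Is \<subseteq> msbox Js \<longleftrightarrow> rel_mset (\<subseteq>) (mset Is) (mset Js)"
proof
  assume "rel_mset (\<subseteq>) (mset Is) (mset Js)"
  then obtain Js' where Js': "mset Js' = mset Js" "list_all2 (\<subseteq>) Is Js'"
    by (auto simp: rel_mset_mset_iff)
  show "msbox Is \<subseteq> msbox Js"
  proof clarify
    fix xs assume "xs \<in> box Is"
    then have "xs \<in> box Js'" using Js'(2) by (auto simp: box_iff list_all2_conv_all_nth subset_iff)
    then obtain ys where "ys \<in> box Js" "mset ys = mset xs"
      using box_reorder_right Js'(1) by metis
    then show "MS (mset xs) \<in> msbox Js" by (metis image_eqI)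
  qed
next
  assume sub: "msbox Is \<subseteq> msbox Js"
  define \<D> where "\<D> = (\<lambda>Ks. Wd ` box Ks) ` {Ks. mset Ks = mset Js}"
  have "\<exists>D\<in>\<D>. Wd ` box Is \<subseteq> D"
  proof (rule ideal_prime[OF quasi_order_qpow[OF qo] Wd_box_ideal[OF Is(1)]])
    show "finite \<D>" unfolding \<D>_def by (intro finite_imageI) (rule mset_eq_finite)
    show "downset (qpow (length Is) Q) D" if D: "D \<in> \<D>" for D
    proof -
      obtain Ks where Ks: "mset Ks = mset Js" "D = Wd ` box Ks" using D by (auto simp: \<D>_def)
      have "length Ks = length Is" "set Ks = set Js"
        using Ks(1) Is(3) by (metis size_mset, metis set_mset_mset)
      then show ?thesis using idealsD(1)[OF Wd_box_ideal[of Ks Q]] Is Ks by simp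
    qed
    show "Wd ` box Is \<subseteq> \<Union>\<D>"
    proof clarify
      fix xs assume "xs \<in> box Is"
      then have "MS (mset xs) \<in> msbox Js" using sub by blast
      then obtain ys where "ys \<in> box Js" "mset xs = mset ys" by auto
      then show "Wd xs \<in> \<Union>\<D>" using box_reorder_left[of ys Js xs] by (auto simp: \<D>_def)
    qed
  qed
  then obtain Ks where Ks: "mset Ks = mset Js" "Wd ` box Is \<subseteq> Wd ` box Ks" by (auto simp: \<D>_def)
  then have "box Is \<subseteq> box Ks" by auto
  moreover have "length Is = length Ks" using Ks(1) Is(3) by (metis size_mset)
  moreover have "\<forall>I\<in>set Is. I \<noteq> {}" using Is(1) idealsD(2) by blast
  ultimately have "list_all2 (\<subseteq>) Is Ks" by (simp add: box_subset_iff)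
  then show "rel_mset (\<subseteq>) (mset Is) (mset Js)" using Ks(1) by (auto simp: rel_mset_mset_iff)
qed

text \<open>The listings of members of \<open>I\<close> form a downset \<open>T\<close> of the power
  that need not be directed. It is a finite union of boxes whose multiset images are downsets, so by
  primality one image contains \<open>I\<close>; it is contained in \<open>I\<close> by the choice
  of \<open>T\<close>.\<close>

lemma ideal_qmsn:
  assumes wqo: "wqo Q" and I: "I \<in> ideals (qmsn n Q)"
  shows "\<exists>Is. set Is \<subseteq> ideals Q \<and> length Is = n \<and> I = msbox Is"
proof -
  note qo = wqo_qo[OF wqo]
  define T where "T = {Wd xs | xs. MS (mset xs) \<in> I}"
  have sub: "set xs \<subseteq> fst Q \<and> length xs = n" if "MS (mset xs) \<in> I" for xs
    using subsetD[OF idealsD(3)[OF I] that] by simp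
  have "downset (qpow n Q) T"
    unfolding downset_def
  proof (intro conjI ballI impI)
    show "T \<subseteq> fst (qpow n Q)" using sub by (auto simp: T_def)
    fix x y assume "x \<in> T" "y \<in> fst (qpow n Q)" "snd (qpow n Q) y x"
    then obtain xs ys where *: "x = Wd xs" "MS (mset xs) \<in> I" "y = Wd ys" "set ys \<subseteq> fst Q"
      "length ys = n" "list_all2 (snd Q) ys xs"
      by (auto simp: fst_qpow T_def)
    have "MS (mset ys) \<in> I"
      by (rule downsetD[OF idealsD(1)[OF I] *(2)]) (use * in \<open>auto simp: mset_emb_def\<close>)
    then show "y \<in> T" using * by (auto simp: T_def)
  qed
  from downset_finite_Union_ideals[OF wqo_qpow[OF wqo] this]
  obtain \<J> where \<J>: "finite \<J>" "\<J> \<subseteq> ideals (qpow n Q)" "\<Union>\<J> = T"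
    by (elim exE conjE)
  define h where "h w = (case w of Wd xs \<Rightarrow> MS (mset xs) | _ \<Rightarrow> w)" for w :: "'a val"
  have h: "h ` Wd ` box Is = msbox Is" for Is by (simp add: image_image h_def)
  have "\<exists>D\<in>(`) h ` \<J>. I \<subseteq> D"
  proof (rule ideal_prime[OF quasi_order_qmsn[OF qo] I])
    show "downset (qmsn n Q) D" if D: "D \<in> (`) h ` \<J>" for D
    proof -
      obtain J where J: "J \<in> \<J>" "D = h ` J" using D by blast
      then obtain Is where "set Is \<subseteq> ideals Q" "length Is = n" "J = Wd ` box Is"
        using ideal_qpow[OF qo] \<J>(2) by blast
      then show ?thesis using downset_msbox[of Is Q] J h by simp
    qed
    show "I \<subseteq> \<Union> ((`) h ` \<J>)"
    proof
      fix w assume w: "w \<in> I"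
      then obtain m where m: "w = MS m" using idealsD(3)[OF I] by (auto simp: fst_qmsn)
      obtain xs where xs: "mset xs = m" using ex_mset by blast
      then have "Wd xs \<in> T" using w m by (auto simp: T_def)
      then obtain J where "J \<in> \<J>" "Wd xs \<in> J" using \<J>(3) by blast
      moreover have "w = h (Wd xs)" using m xs by (simp add: h_def)
      ultimately show "w \<in> \<Union> ((`) h ` \<J>)" by blast
    qed
  qed (use \<J>(1) in auto)
  then obtain J where J: "J \<in> \<J>" "I \<subseteq> h ` J" by blast
  then obtain Is where Is: "set Is \<subseteq> ideals Q" "length Is = n" "J = Wd ` box Is"
    using ideal_qpow[OF qo] \<J>(2) by blast
  have "msbox Is \<subseteq> I" using J(1) Is(3) \<J>(3) by (auto simp: T_def)
  with J(2) Is h show ?thesis by auto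
qed

lemma ideal_emb_qmsn:
  assumes wqo: "wqo Q" and "ideal_emb Q P"
  shows "ideal_emb (qmsn n Q) (qms P)"
proof -
  obtain \<phi> where \<phi>: "\<And>I. I \<in> ideals Q \<Longrightarrow> \<phi> I \<in> fst P"
    "\<And>I J. I \<in> ideals Q \<Longrightarrow> J \<in> ideals Q \<Longrightarrow> snd P (\<phi> I) (\<phi> J) \<longleftrightarrow> I \<subseteq> J"
    using assms(2) by (rule ideal_embE) blast
  let ?L = "\<lambda>I p. \<exists>Is. set Is \<subseteq> ideals Q \<and> length Is = n \<and> I = msbox Is \<and> p = MS (image_mset \<phi> (mset Is))"
  show ?thesis
  proof (rule ideal_embI[where L = ?L])
    fix I assume "I \<in> ideals (qmsn n Q)"
    then obtain Is where "set Is \<subseteq> ideals Q" "length Is = n" "I = msbox Is"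
      using ideal_qmsn[OF wqo] by blast
    then show "\<exists>p\<in>fst (qms P). ?L I p"
      using \<phi>(1) by (intro bexI[of _ "MS (image_mset \<phi> (mset Is))"]) auto
  next
    fix I J p q assume "?L I p" "?L J q"
    then obtain Is Js where *: "set Is \<subseteq> ideals Q" "length Is = n" "I = msbox Is"
      "p = MS (image_mset \<phi> (mset Is))"
      "set Js \<subseteq> ideals Q" "length Js = n" "J = msbox Js" "q = MS (image_mset \<phi> (mset Js))" by blast
    have "snd (qms P) p q \<longleftrightarrow> rel_mset (snd P) (image_mset \<phi> (mset Is)) (image_mset \<phi> (mset Js))"
      using * by (simp add: mset_emb_same_size)
    also have "\<dots> \<longleftrightarrow> rel_mset (\<lambda>I J. snd P (\<phi> I) (\<phi> J)) (mset Is) (mset Js)"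
      by (simp only: multiset.rel_map)
    also have "\<dots> \<longleftrightarrow> rel_mset (\<subseteq>) (mset Is) (mset Js)"
      using *(1,5) by (intro multiset.rel_cong refl \<phi>(2)) auto
    also have "\<dots> \<longleftrightarrow> I \<subseteq> J"
      using * msbox_subset_iff[OF wqo_qo[OF wqo], of Is Js] by simp
    finally show "snd (qms P) p q \<longleftrightarrow> I \<subseteq> J" .
  qed
qed

section \<open>Downsets as finite sets of ideals, and ideals of finite powersets\<close>

lemma Union_ideals_subset_iff:
  assumes "quasi_order Q" "finite \<J>" "\<I> \<subseteq> ideals Q" "\<J> \<subseteq> ideals Q"
  shows "\<Union>\<I> \<subseteq> \<Union>\<J> \<longleftrightarrow> (\<forall>I\<in>\<I>. \<exists>J\<in>\<J>. I \<subseteq> J)"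
proof
  assume sub: "\<Union>\<I> \<subseteq> \<Union>\<J>"
  show "\<forall>I\<in>\<I>. \<exists>J\<in>\<J>. I \<subseteq> J"
  proof
    fix I assume I: "I \<in> \<I>"
    show "\<exists>J\<in>\<J>. I \<subseteq> J"
      by (rule ideal_prime[OF assms(1) _ assms(2)]) (use I sub assms(3,4) idealsD(1) in blast)+
  qed
qed blast

text \<open>Any finite decomposition into ideals serves as a code: primality turns inclusion of the
  unions into the Hoare order on the decompositions, and \<open>\<phi>\<close> carries this order
  into \<open>P\<close>.\<close>

lemma downset_emb:
  assumes wqo: "wqo Q" and "ideal_emb Q P"
  shows "\<exists>\<psi>. (\<forall>D. downset Q D \<longrightarrow> \<psi> D \<in> fst (qpf P)) \<and>
    (\<forall>D E. downset Q D \<longrightarrow> downset Q E \<longrightarrow> (snd (qpf P) (\<psi> D) (\<psi> E) \<longleftrightarrow> D \<subseteq> E))"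
proof -
  obtain \<phi> where \<phi>: "\<And>I. I \<in> ideals Q \<Longrightarrow> \<phi> I \<in> fst P"
    "\<And>I J. I \<in> ideals Q \<Longrightarrow> J \<in> ideals Q \<Longrightarrow> snd P (\<phi> I) (\<phi> J) \<longleftrightarrow> I \<subseteq> J"
    using assms(2) by (rule ideal_embE) blast
  obtain dec where dec: "\<And>D. downset Q D \<Longrightarrow> finite (dec D) \<and> dec D \<subseteq> ideals Q \<and> \<Union>(dec D) = D"
    using downset_finite_Union_ideals[OF wqo] by metis
  define \<psi> where "\<psi> D = FS (Abs_fset (\<phi> ` dec D))" for D
  have fset: "fset (Abs_fset (\<phi> ` dec D)) = \<phi> ` dec D" if "downset Q D" for D
    using dec[OF that] by (simp add: Abs_fset_inverse)
  show ?thesis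
  proof (intro exI[of _ \<psi>] conjI allI impI)
    show "\<psi> D \<in> fst (qpf P)" if "downset Q D" for D
      using dec[OF that] fset[OF that] \<phi>(1) by (auto simp: \<psi>_def)
    fix D E assume D: "downset Q D" and E: "downset Q E"
    have "D \<subseteq> E \<longleftrightarrow> (\<forall>I\<in>dec D. \<exists>J\<in>dec E. I \<subseteq> J)"
      using Union_ideals_subset_iff[OF wqo_qo[OF wqo], of "dec E" "dec D"] dec[OF D] dec[OF E] by simp
    also have "\<dots> \<longleftrightarrow> (\<forall>I\<in>dec D. \<exists>J\<in>dec E. snd P (\<phi> I) (\<phi> J))"
      using \<phi>(2) dec[OF D] dec[OF E] by (intro ball_cong bex_cong refl) (metis subsetD)
    finally show "snd (qpf P) (\<psi> D) (\<psi> E) \<longleftrightarrow> D \<subseteq> E"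
      by (simp add: \<psi>_def fset[OF D] fset[OF E])
  qed
qed

text \<open>Each element of a finite subset \<open>s\<close> of the union \<open>U\<close> occurs in
  some member of \<open>I\<close>; an upper bound of these members in \<open>I\<close> dominates
  \<open>s\<close>, so \<open>s\<close> belongs to \<open>I\<close>. An empty \<open>U\<close> is
  possible and gives the ideal consisting of the empty set.\<close>

lemma ideal_qpf:
  assumes qo: "quasi_order Q" and I: "I \<in> ideals (qpf Q)"
  shows "\<exists>U. downset Q U \<and> I = {FS s | s. fset s \<subseteq> U}"
proof -
  note D = downsetD[OF idealsD(1)[OF I]]
  have isFS: "\<exists>s. w = FS s \<and> fset s \<subseteq> fst Q" if "w \<in> I" for w
    using that idealsD(3)[OF I] by (auto simp: fst_qpf)
  define U where "U = (\<Union>s\<in>{s. FS s \<in> I}. fset s)"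
  have UQ: "U \<subseteq> fst Q" using isFS by (fastforce simp: U_def)
  have U: "downset Q U"
    unfolding downset_def
  proof (intro conjI ballI impI)
    fix x y assume "x \<in> U" "y \<in> fst Q" "snd Q y x"
    then obtain s where "FS s \<in> I" "x \<in> fset s" by (auto simp: U_def)
    then have "FS {|y|} \<in> I"
      using D[of "FS s" "FS {|y|}"] \<open>y \<in> fst Q\<close> \<open>snd Q y x\<close> by auto
    then show "y \<in> U" by (auto simp: U_def)
  qed (rule UQ)
  have "FS s \<in> I" if s: "fset s \<subseteq> U" for s
  proof -
    have "\<forall>a\<in>fset s. \<exists>t. FS t \<in> I \<and> a \<in> fset t" using s by (auto simp: U_def)
    then obtain d where d: "\<And>a. a \<in> fset s \<Longrightarrow> FS (d a) \<in> I \<and> a \<in> fset (d a)" by metis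
    have "finite ((\<lambda>a. FS (d a)) ` fset s)" "(\<lambda>a. FS (d a)) ` fset s \<subseteq> I" using d by auto
    from ideal_finite_ub[OF quasi_order_qpf[OF qo] I this]
    obtain w where w: "w \<in> I" "\<forall>v\<in>(\<lambda>a. FS (d a)) ` fset s. snd (qpf Q) v w" by blast
    obtain t where t: "w = FS t" using isFS[OF w(1)] by blast
    show ?thesis
      by (rule D[OF w(1)]) (use s UQ w(2) d t in \<open>auto simp: subset_eq\<close>)
  qed
  moreover have "\<exists>s. w = FS s \<and> fset s \<subseteq> U" if "w \<in> I" for w
    using isFS[OF that] that by (auto simp: U_def)
  ultimately have "I = {FS s | s. fset s \<subseteq> U}" by (intro set_eqI) auto
  with U show ?thesis by (intro exI[of _ U] conjI)
qed

text \<open>Ideals of \<open>qpf Q\<close> are compared like the downsets that support them,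
  recovered through singletons, so codes of downsets are codes of these ideals.\<close>

lemma ideal_emb_qpf:
  assumes wqo: "wqo Q" and "ideal_emb Q P"
  shows "ideal_emb (qpf Q) (qpf P)"
proof -
  obtain \<psi> where \<psi>: "\<forall>D. downset Q D \<longrightarrow> \<psi> D \<in> fst (qpf P)"
    "\<forall>D E. downset Q D \<longrightarrow> downset Q E \<longrightarrow> (snd (qpf P) (\<psi> D) (\<psi> E) \<longleftrightarrow> D \<subseteq> E)"
    using downset_emb[OF assms] by (elim exE conjE)
  let ?L = "\<lambda>I p. \<exists>U. downset Q U \<and> I = {FS s | s. fset s \<subseteq> U} \<and> p = \<psi> U"
  show ?thesis
  proof (rule ideal_embI[where L = ?L])
    show "\<exists>p\<in>fst (qpf P). ?L I p" if I: "I \<in> ideals (qpf Q)" for I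
    proof -
      obtain U where "downset Q U" "I = {FS s | s. fset s \<subseteq> U}"
        using ideal_qpf[OF wqo_qo[OF wqo] I] by (elim exE conjE)
      then show ?thesis using \<psi>(1) by (intro bexI[of _ "\<psi> U"] exI[of _ U] conjI) auto
    qed
    fix I J p q assume L: "?L I p" "?L J q"
    obtain U where U: "downset Q U" "I = {FS s | s. fset s \<subseteq> U}" "p = \<psi> U"
      using L(1) by (elim exE conjE)
    obtain V where V: "downset Q V" "J = {FS s | s. fset s \<subseteq> V}" "q = \<psi> V"
      using L(2) by (elim exE conjE)
    have "U \<subseteq> V" if "I \<subseteq> J"
    proof
      fix x assume "x \<in> U"
      then have "FS {|x|} \<in> I" unfolding U(2) by auto
      then have "FS {|x|} \<in> J" using that by blast
      then show "x \<in> V" unfolding V(2) by auto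
    qed
    moreover have "I \<subseteq> J" if "U \<subseteq> V"
      unfolding U(2) V(2) using that by (auto dest: subset_trans)
    ultimately show "snd (qpf P) p q \<longleftrightarrow> I \<subseteq> J" using \<psi>(2) U(1,3) V(1,3) by auto
  qed
qed

lemma approx_ideal_emb: "elementary e \<Longrightarrow> approx e Q \<Longrightarrow> ideal_emb Q (sem e)"
proof (induction e arbitrary: Q)
  case (EOrd r)
  then show ?case
    by (auto simp: admissible_ord_def mult_indec_def
        intro!: ideal_emb_wpo_iso[OF _ ideal_emb_qord_seg])
next
  case (ESum e1 e2)
  then show ?case
    by (simp only: approx.simps elementary.simps sem.simps) (meson ideal_emb_wpo_iso ideal_emb_qsum)
next
  case (EProd e1 e2)
  then show ?case
    by (simp only: approx.simps elementary.simps sem.simps)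
      (meson ideal_emb_wpo_iso ideal_emb_qprod approx_wqo wqo_qo)
next
  case (EStar e)
  then show ?case
    by (simp only: approx.simps elementary.simps sem.simps)
      (meson ideal_emb_wpo_iso ideal_emb_qpow approx_wqo wqo_qo)
next
  case (EMs e)
  then show ?case
    by (simp only: approx.simps elementary.simps sem.simps)
      (meson ideal_emb_wpo_iso ideal_emb_qmsn approx_wqo)
next
  case (EPf e)
  then show ?case
    by (simp only: approx.simps elementary.simps sem.simps)
      (meson ideal_emb_wpo_iso ideal_emb_qpf approx_wqo)
qed

section \<open>Approximations absorb finitely generated downsets\<close>

text \<open>A copy of \<open>Q\<close> inside \<open>Q\<close> with an element \<open>z\<close> of \<open>Q\<close> above none of its members: \<open>z\<close> serves to pad
  words and multisets to a fixed size.\<close>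
definition shift :: "'v qo \<Rightarrow> ('v \<Rightarrow> 'v) \<Rightarrow> 'v \<Rightarrow> bool" where
  "shift Q g z \<longleftrightarrow> z \<in> fst Q \<and> (\<forall>x\<in>fst Q. g x \<in> fst Q \<and> \<not> snd Q (g x) z) \<and>
     (\<forall>x\<in>fst Q. \<forall>y\<in>fst Q. snd Q (g x) (g y) \<longleftrightarrow> snd Q x y)"

lemma shiftI:
  assumes "z \<in> fst Q" "\<And>x. x \<in> fst Q \<Longrightarrow> g x \<in> fst Q" "\<And>x. x \<in> fst Q \<Longrightarrow> \<not> snd Q (g x) z"
    "\<And>x y. x \<in> fst Q \<Longrightarrow> y \<in> fst Q \<Longrightarrow> snd Q x y \<Longrightarrow> snd Q (g x) (g y)"
    "\<And>x y. x \<in> fst Q \<Longrightarrow> y \<in> fst Q \<Longrightarrow> snd Q (g x) (g y) \<Longrightarrow> snd Q x y"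
  shows "shift Q g z"
  using assms unfolding shift_def by blast

lemma shiftD:
  assumes "shift Q g z"
  shows "z \<in> fst Q" "x \<in> fst Q \<Longrightarrow> g x \<in> fst Q" "x \<in> fst Q \<Longrightarrow> \<not> snd Q (g x) z"
    "x \<in> fst Q \<Longrightarrow> y \<in> fst Q \<Longrightarrow> snd Q (g x) (g y) \<longleftrightarrow> snd Q x y"
  using assms unfolding shift_def by blast+

text \<open>The third property makes the copy of \<omega> initial, so that every other element of
  \<open>Field r\<close> lies above all of it when \<open>r\<close> is total.\<close>

lemma omega_segment:
  assumes "(natLeq, r) \<in> ordLess"
  obtains h :: "nat \<Rightarrow> 'a" where "\<And>n. h n \<in> Field r" "\<And>m n. (h m, h n) \<in> r \<longleftrightarrow> m \<le> n"
    "\<And>y n. (y, h n) \<in> r \<Longrightarrow> y \<in> range h"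
proof -
  obtain h where h: "embed natLeq r h" and r: "Well_order r"
    using assms by (auto simp: ordLess_def embedS_def)
  have under: "under natLeq n = {..n}" for n by (auto simp: under_def natLeq_def)
  have bij: "bij_betw h {..n} (under r (h n))" for n
    using h under by (auto simp: embed_def Field_natLeq)
  have inj: "inj h"
    using embed_inj_on[OF natLeq_Well_order h] by (simp add: Field_natLeq)
  have eq: "under r (h n) = h ` {..n}" for n using bij by (auto simp: bij_betw_def)
  have iff: "(y, h n) \<in> r \<longleftrightarrow> y \<in> h ` {..n}" for y n using eq[of n] by (auto simp: under_def)
  show thesis
  proof (rule that)
    show "h n \<in> Field r" for n using iff[of "h n" n] by (auto simp: Field_def)
    show "(h m, h n) \<in> r \<longleftrightarrow> m \<le> n" for m n using inj by (auto simp: iff dest: injD)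
    show "y \<in> range h" if "(y, h n) \<in> r" for y n using that by (auto simp: iff)
  qed
qed

text \<open>This realises 1 + \<alpha> = \<alpha>: the map is the successor on the initial copy of
  \<omega> and the identity above it, which frees the least element to be \<open>z\<close>.\<close>

lemma shift_qord:
  assumes r: "Well_order r" and "(natLeq, r) \<in> ordLess"
  shows "\<exists>g z. shift (qord r) g z"
proof -
  obtain h :: "nat \<Rightarrow> 'a" where h: "\<And>n. h n \<in> Field r" "\<And>m n. (h m, h n) \<in> r \<longleftrightarrow> m \<le> n"
    "\<And>y n. (y, h n) \<in> r \<Longrightarrow> y \<in> range h"
    using assms(2) by (rule omega_segment) blast
  have inj: "h m = h n \<longleftrightarrow> m = n" for m n by (metis h(2) order_antisym order_refl)
  define k where "k x = (if x \<in> range h then h (Suc (inv h x)) else x)" for x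
  have inv: "inv h (h n) = n" for n using inj by (auto simp: inj_def intro: inv_f_f)
  have k: "k (h n) = h (Suc n)" "x \<notin> range h \<Longrightarrow> k x = x" for n x by (auto simp: k_def inv)
  have out: "(h n, x) \<in> r \<and> (x, h n) \<notin> r" if "x \<in> Field r" "x \<notin> range h" for n x
    using that h(1,3) Well_orderD(4)[OF r] by blast
  have mono: "(k x, k y) \<in> r \<longleftrightarrow> (x, y) \<in> r" if "x \<in> Field r" "y \<in> Field r" for x y
    by (cases "x \<in> range h"; cases "y \<in> range h") (use that out in \<open>auto simp: k h(2)\<close>)
  define g where "g w = (case w of Atm x \<Rightarrow> Atm (k x) | _ \<Rightarrow> w)" for w :: "'a val"
  have "k x \<in> Field r" if "x \<in> Field r" for x using that h(1) by (simp add: k_def)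
  moreover have "(k x, h 0) \<notin> r" if "x \<in> Field r" for x
    by (cases "x \<in> range h") (use that out in \<open>auto simp: k h(2)\<close>)
  ultimately have "shift (qord r) g (Atm (h 0))"
    by (intro shiftI) (auto simp: g_def h(1) mono)
  then show ?thesis by blast
qed

lemma shift_sem: "elementary e \<Longrightarrow> \<exists>g z. shift (sem e) g z"
proof (induction e)
  case (EOrd r)
  then show ?case by (auto simp: admissible_ord_def mult_indec_def intro: shift_qord)
next
  case (ESum e1 e2)
  then obtain g z where g: "shift (sem e1) g z" by auto
  \<comment> \<open>The right summand stays fixed, since none of its elements lies below
    \<open>InL z\<close>.\<close>
  define G where "G w = (case w of InL x \<Rightarrow> InL (g x) | _ \<Rightarrow> w)" for w
  have "shift (sem (ESum e1 e2)) G (InL z)"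
    by (intro shiftI) (auto simp: G_def shiftD[OF g])
  then show ?case by blast
next
  case (EProd e1 e2)
  then obtain g z g' z' where g: "shift (sem e1) g z" "shift (sem e2) g' z'" by auto
  define G where "G w = (case w of Pr x y \<Rightarrow> Pr (g x) (g' y) | _ \<Rightarrow> w)" for w
  have "shift (sem (EProd e1 e2)) G (Pr z z')"
    by (intro shiftI) (auto simp: G_def fst_qprod shiftD[OF g(1)] shiftD[OF g(2)])
  then show ?case by blast
next
  case (EStar e)
  then obtain g z where g: "shift (sem e) g z" by auto
  have qo: "quasi_order (sem e)" using EStar by (simp add: quasi_order_sem)
  have zz: "snd (sem e) z z" using qo_refl[OF qo] shiftD(1)[OF g] by blast
  \<comment> \<open>A common first letter can be cancelled from an embedding, so prefixing
    \<open>z\<close> reflects the order, and no prefixed word embeds into the empty word.\<close>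
  define G where "G w = (case w of Wd xs \<Rightarrow> Wd (z # xs) | _ \<Rightarrow> w)" for w
  have "shift (sem (EStar e)) G (Wd [])"
    by (intro shiftI) (auto simp: G_def fst_qstar shiftD(1)[OF g] zz)
  then show ?case by blast
next
  case (EMs e)
  then obtain g z where g: "shift (sem e) g z" by auto
  have qo: "quasi_order (sem e)" using EMs by (simp add: quasi_order_sem)
  have zz: "snd (sem e) z z" using qo_refl[OF qo] shiftD(1)[OF g] by blast
  \<comment> \<open>Applying \<open>g\<close> keeps the letters of \<open>m\<close> from being
    matched with the added \<open>z\<close>, which makes the addition cancellable; the added
    \<open>z\<close> makes every image nonempty.\<close>
  define G where "G w = (case w of MS m \<Rightarrow> MS (image_mset g m + {#z#}) | _ \<Rightarrow> w)" for w
  have "shift (sem (EMs e)) G (MS {#})"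
  proof (intro shiftI)
    fix x y assume "x \<in> fst (sem (EMs e))" "y \<in> fst (sem (EMs e))"
    then obtain m m' where m: "x = MS m" "y = MS m'" "set_mset m \<subseteq> fst (sem e)" "set_mset m' \<subseteq> fst (sem e)"
      by (auto simp: fst_qms)
    show "snd (sem (EMs e)) (G x) (G y)" if "snd (sem (EMs e)) x y"
    proof -
      have "mset_emb (snd (sem e)) (image_mset g m) (image_mset g m')"
        using that m by (intro mset_emb_image[of "snd (sem e)"]) (auto simp: shiftD[OF g] subset_iff)
      then obtain N where N: "N \<subseteq># image_mset g m'" "rel_mset (snd (sem e)) (image_mset g m) N"
        by (auto simp: mset_emb_iff_rel_mset)
      then have "rel_mset (snd (sem e)) (add_mset z (image_mset g m)) (add_mset z N)"
        using zz by (intro rel_mset_Plus)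
      moreover have "add_mset z N \<subseteq># add_mset z (image_mset g m')" using N(1) by simp
      ultimately have "mset_emb (snd (sem e)) (add_mset z (image_mset g m)) (add_mset z (image_mset g m'))"
        unfolding mset_emb_iff_rel_mset by blast
      then show ?thesis using m by (simp add: G_def)
    qed
    show "snd (sem (EMs e)) x y" if "snd (sem (EMs e)) (G x) (G y)"
    proof -
      have "mset_emb (snd (sem e)) (image_mset g m + {#z#}) (image_mset g m' + replicate_mset 1 z)"
        using that m by (simp add: G_def)
      then have "mset_emb (\<lambda>x y. snd (sem e) (g x) (g y)) m m'"
        by (rule mset_emb_cancel_padding) (use m shiftD[OF g] in blast)
      then have "mset_emb (snd (sem e)) m m'"
        by (rule mset_emb_mono) (use m shiftD(4)[OF g] in blast)
      then show ?thesis using m by simp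
    qed
  next
    fix x assume "x \<in> fst (sem (EMs e))"
    then obtain m where m: "x = MS m" "set_mset m \<subseteq> fst (sem e)" by (auto simp: fst_qms)
    show "G x \<in> fst (sem (EMs e))" using m shiftD[OF g] by (auto simp: G_def)
    show "\<not> snd (sem (EMs e)) (G x) (MS {#})"
      using m by (auto simp: G_def mset_emb_iff_rel_mset)
  qed auto
  then show ?case by blast
next
  case (EPf e)
  then obtain g z where g: "shift (sem e) g z" by auto
  have qo: "quasi_order (sem e)" using EPf by (simp add: quasi_order_sem)
  have zz: "snd (sem e) z z" using qo_refl[OF qo] shiftD(1)[OF g] by blast
  \<comment> \<open>Shifting by \<open>g\<close> first prevents the added \<open>z\<close> from
    dominating members of the set in the Hoare order.\<close>
  define G where "G w = (case w of FS s \<Rightarrow> FS (finsert z (g |`| s)) | _ \<Rightarrow> w)" for w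
  have "shift (sem (EPf e)) G (FS {||})"
  proof (intro shiftI)
    fix x y assume "x \<in> fst (sem (EPf e))" "y \<in> fst (sem (EPf e))"
    then obtain s t where m: "x = FS s" "y = FS t" "fset s \<subseteq> fst (sem e)" "fset t \<subseteq> fst (sem e)"
      by (auto simp: fst_qpf)
    have iff: "snd (sem e) (g a) (g b) \<longleftrightarrow> snd (sem e) a b" "\<not> snd (sem e) (g a) z"
      if "a \<in> fset s" "b \<in> fset t" for a b
      using that m shiftD[OF g] by blast+
    have nz: "\<not> snd (sem e) (g a) z" if "a \<in> fset s" for a
      using that m shiftD[OF g] by blast
    show "snd (sem (EPf e)) (G x) (G y)" if "snd (sem (EPf e)) x y"
      using that m iff zz by (fastforce simp: G_def)
    show "snd (sem (EPf e)) x y" if "snd (sem (EPf e)) (G x) (G y)"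
      using that m iff nz by (fastforce simp: G_def)
  qed (use shiftD[OF g] in \<open>auto simp: fst_qpf G_def subset_iff\<close>)
  then show ?case by blast
qed

section \<open>Absence of a maximum in admissible ordinals\<close>

lemma ordLess_no_strict_mono:
  assumes less: "(s, r) \<in> ordLess"
    and j: "\<And>x. x \<in> Field r \<Longrightarrow> j x \<in> Field s"
      "\<And>x y. (x, y) \<in> r \<Longrightarrow> x \<noteq> y \<Longrightarrow> (j x, j y) \<in> s \<and> j x \<noteq> j y"
  shows False
proof -
  obtain f where f: "embed s r f" "\<not> bij_betw f (Field s) (Field r)"
    and s: "Well_order s" and r: "Well_order r"
    using less by (auto simp: ordLess_def embedS_def)
  have inj: "inj_on f (Field s)" by (rule embed_inj_on[OF s f(1)])
  have comp: "(f x, f y) \<in> r" if "(x, y) \<in> s" for x y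
    using embed_compat[OF f(1)] that by (auto simp: compat_def)
  have "wo_rel.ofilter r (f ` Field s)" by (rule embed_Field_ofilter[OF s r f(1)])
  moreover have "f ` Field s \<noteq> Field r" using f(2) inj by (auto simp: bij_betw_def)
  ultimately obtain a where a: "a \<in> Field r" "f ` Field s = underS r a"
    by (auto simp: wo_rel.ofilter_underS_Field[OF wo_rel.intro[OF r]])
  \<comment> \<open>\<open>k\<close> is strictly increasing from \<open>r\<close> into the segment
    below \<open>a\<close>, so it moves \<open>a\<close> down. For the least \<open>x\<close> that
    is moved down, \<open>k x\<close> is smaller and moved down as well, a contradiction.\<close>
  define k where "k x = f (j x)" for x
  have k: "k x \<in> underS r a" if "x \<in> Field r" for x
    using a(2) j(1)[OF that] by (auto simp: k_def)
  have mono: "(k x, k y) \<in> r - Id" if "(x, y) \<in> r - Id" for x y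
  proof -
    have "x \<in> Field r" "y \<in> Field r" using that by (auto simp: Field_def)
    then show ?thesis using j comp inj that by (auto simp: k_def dest: inj_onD)
  qed
  have "wf (r - Id)" using r by (simp add: well_order_on_def)
  moreover have "a \<in> {x. (k x, x) \<in> r - Id}" using k[OF a(1)] by (auto simp: underS_def)
  ultimately obtain x where x: "(k x, x) \<in> r - Id" "\<And>y. (y, x) \<in> r - Id \<Longrightarrow> (k y, y) \<notin> r - Id"
    by (metis (mono_tags, lifting) mem_Collect_eq wfE_min)
  then show False using mono[OF x(1)] by blast
qed

text \<open>With a maximum \<open>m\<close>, the order is the segment below \<open>m\<close> plus
  one point. That point fits into a second copy of the segment, so \<open>r\<close> would embed
  strictly into a product of two of its own segments.\<close>

lemma admissible_ord_no_max:
  assumes adm: "admissible_ord r" and m: "m \<in> Field r"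
  shows "\<exists>a\<in>Field r. (m, a) \<in> r \<and> a \<noteq> m"
proof (rule ccontr)
  assume max: "\<not> (\<exists>a\<in>Field r. (m, a) \<in> r \<and> a \<noteq> m)"
  have r: "Well_order r" and om: "(natLeq, r) \<in> ordLess"
    and ind: "(oprod_rel (seg r m) (seg r m), r) \<in> ordLess"
    using adm m by (auto simp: admissible_ord_def mult_indec_def)
  obtain h :: "nat \<Rightarrow> 'a" where h: "\<And>n. h n \<in> Field r" "\<And>m n. (h m, h n) \<in> r \<longleftrightarrow> m \<le> n"
    using om by (rule omega_segment) blast
  have le_m: "(x, m) \<in> r" if "x \<in> Field r" for x
    using max that m Well_orderD(1,4)[OF r] by metis
  \<comment> \<open>The copy of \<omega> lies strictly below \<open>m\<close>, because
    \<open>h (Suc n)\<close> exceeds \<open>h n\<close>. Hence the segment has at least the two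
    points \<open>h 0\<close> and \<open>h 1\<close>.\<close>
  have neq: "h n \<noteq> m" for n
    using le_m[OF h(1), of "Suc n"] h(2)[of "Suc n" n] by auto
  have hm: "h n \<in> underS r m" for n using le_m[OF h(1)] neq by (auto simp: underS_def)
  have F: "Field (seg r m) = underS r m" by (rule Field_seg[OF r])
  have seg: "(x, y) \<in> seg r m \<longleftrightarrow> (x, y) \<in> r \<and> x \<in> underS r m \<and> y \<in> underS r m" for x y
    by (auto simp: seg_def)
  have h01: "h 0 \<noteq> h 1" using h(2)[of 1 0] h(2)[of 0 0] by auto
  \<comment> \<open>The second coordinate dominates in \<open>oprod_rel\<close>: the segment fills
    the copy indexed by \<open>h 0\<close>, and \<open>m\<close> goes into the later copy indexed by
    \<open>h 1\<close>.\<close>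
  define j where "j x = (if x = m then (h 0, h 1) else (x, h 0))" for x
  have refl: "(x, x) \<in> seg r m" if "x \<in> underS r m" for x
    using that Well_orderD(1)[OF r] by (auto simp: seg underS_def Field_def)
  have pair: "(p, q) \<in> oprod_rel (seg r m) (seg r m) \<longleftrightarrow>
      fst p \<in> underS r m \<and> fst q \<in> underS r m \<and> snd p \<in> underS r m \<and> snd q \<in> underS r m \<and>
      (((snd p, snd q) \<in> seg r m \<and> snd p \<noteq> snd q) \<or> (snd p = snd q \<and> (fst p, fst q) \<in> seg r m))" for p q
    by (cases p; cases q) (simp add: oprod_rel_def F)
  show False
  proof (rule ordLess_no_strict_mono[OF ind])
    fix x assume x: "x \<in> Field r"
    then have "fst (j x) \<in> underS r m \<and> snd (j x) \<in> underS r m"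
      using hm le_m by (auto simp: j_def underS_def)
    then have "(j x, j x) \<in> oprod_rel (seg r m) (seg r m)" using refl by (simp add: pair)
    then show "j x \<in> Field (oprod_rel (seg r m) (seg r m))" by (auto simp: Field_def)
  next
    fix x y assume xy: "(x, y) \<in> r" "x \<noteq> y"
    have F: "x \<in> Field r" "y \<in> Field r" using xy by (auto simp: Field_def)
    have "x \<noteq> m" using xy max F by blast
    then have x: "x \<in> underS r m" using le_m F by (auto simp: underS_def)
    show "(j x, j y) \<in> oprod_rel (seg r m) (seg r m) \<and> j x \<noteq> j y"
    proof (cases "y = m")
      case True
      have "(h 0, h 1) \<in> seg r m" using h(2)[of 0 1] hm by (simp add: seg)
      then show ?thesis using True \<open>x \<noteq> m\<close> x hm h01 by (simp add: j_def pair)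
    next
      case False
      then have "y \<in> underS r m" using le_m F by (auto simp: underS_def)
      then show ?thesis using False \<open>x \<noteq> m\<close> x hm xy by (simp add: j_def pair seg)
    qed
  qed
qed

section \<open>Covering finitely generated downsets by approximations\<close>

definition down :: "'v qo \<Rightarrow> 'v set \<Rightarrow> 'v set" where
  "down Q S = {x \<in> fst Q. \<exists>b\<in>S. snd Q x b}"

text \<open>Reflection of the order on \<open>A\<close> is what sends bad sequences in
  \<open>A\<close> to bad sequences of \<open>R\<close>.\<close>

definition reflecting :: "('v \<Rightarrow> 'w) \<Rightarrow> 'v set \<Rightarrow> 'v qo \<Rightarrow> 'w qo \<Rightarrow> bool" where
  "reflecting f A Q R \<longleftrightarrow> (\<forall>x\<in>A. f x \<in> fst R) \<and> (\<forall>x\<in>A. \<forall>y\<in>A. snd R (f x) (f y) \<longrightarrow> snd Q x y)"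

lemma reflectingI:
  assumes "\<And>x. x \<in> A \<Longrightarrow> f x \<in> fst R"
    and "\<And>x y. x \<in> A \<Longrightarrow> y \<in> A \<Longrightarrow> snd R (f x) (f y) \<Longrightarrow> snd Q x y"
  shows "reflecting f A Q R"
  using assms by (auto simp: reflecting_def)

lemma reflectingD:
  assumes "reflecting f A Q R"
  shows "x \<in> A \<Longrightarrow> f x \<in> fst R" and "x \<in> A \<Longrightarrow> y \<in> A \<Longrightarrow> snd R (f x) (f y) \<Longrightarrow> snd Q x y"
  using assms by (auto simp: reflecting_def)

text \<open>A bound \<open>b\<close> of \<open>S\<close> is not enough, since segments are strict: a
  point \<open>a\<close> above \<open>b\<close> exists because there is no maximum.\<close>

lemma cover_qord:
  assumes adm: "admissible_ord r" and S: "finite S" "S \<subseteq> fst (qord r)"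
  shows "\<exists>Q f. approx (EOrd r) Q \<and> reflecting f (down (qord r) S) (qord r) Q"
proof -
  have r: "Well_order r" and om: "(natLeq, r) \<in> ordLess"
    using adm by (auto simp: admissible_ord_def mult_indec_def)
  have "Field r \<noteq> {}" by (rule omega_segment[OF om]) blast
  \<comment> \<open>The whole carrier is an ideal, so finite sets are bounded in it, including an
    empty \<open>S\<close>.\<close>
  have "fst (qord r) \<in> ideals (qord r)"
  proof (rule idealsI)
    show "\<exists>z\<in>fst (qord r). snd (qord r) x z \<and> snd (qord r) y z"
      if "x \<in> fst (qord r)" "y \<in> fst (qord r)" for x y
      using that Well_orderD(1,4)[OF r] by (auto simp: image_iff) metis
  qed (use \<open>Field r \<noteq> {}\<close> in \<open>auto simp: downset_def\<close>)
  from ideal_finite_ub[OF quasi_order_qord[OF r] this S]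
  obtain b where b: "b \<in> Field r" "\<forall>x\<in>S. snd (qord r) x (Atm b)" by auto
  obtain a where a: "a \<in> Field r" "(b, a) \<in> r" "a \<noteq> b"
    using admissible_ord_no_max[OF adm b(1)] by blast
  have "down (qord r) S \<subseteq> Atm ` underS r a"
  proof
    fix w assume "w \<in> down (qord r) S"
    then obtain x y where xy: "w = Atm x" "x \<in> Field r" "Atm y \<in> S" "(x, y) \<in> r"
      using S(2) by (auto simp: down_def subset_iff)
    then have "(y, b) \<in> r" using b(2) by auto
    then have "(x, b) \<in> r" using xy(4) Well_orderD(2)[OF r] by blast
    then have "(x, a) \<in> r" "x \<noteq> a" using a Well_orderD(2,3)[OF r] by blast+
    then show "w \<in> Atm ` underS r a" using xy(1) by (auto simp: underS_def)
  qed
  then have "reflecting id (down (qord r) S) (qord r) (qord (seg r a))"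
    unfolding reflecting_def by (auto simp: Field_seg[OF r] down_def) (auto simp: seg_def)
  moreover have "approx (EOrd r) (qord (seg r a))"
    using a(1) wpo_iso_refl[OF quasi_order_qord[OF Well_order_seg[OF r]]] by auto
  ultimately show ?thesis by blast
qed

lemma approx_construct:
  "elementary e1 \<Longrightarrow> elementary e2 \<Longrightarrow> approx e1 Q1 \<Longrightarrow> approx e2 Q2 \<Longrightarrow> approx (ESum e1 e2) (qsum Q1 Q2)"
  "elementary e1 \<Longrightarrow> elementary e2 \<Longrightarrow> approx e1 Q1 \<Longrightarrow> approx e2 Q2 \<Longrightarrow> approx (EProd e1 e2) (qprod Q1 Q2)"
  "elementary e1 \<Longrightarrow> approx e1 Q1 \<Longrightarrow> approx (EStar e1) (qpow n Q1)"
  "elementary e1 \<Longrightarrow> approx e1 Q1 \<Longrightarrow> approx (EMs e1) (qmsn n Q1)"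
  "elementary e1 \<Longrightarrow> approx e1 Q1 \<Longrightarrow> approx (EPf e1) (qpf Q1)"
  by (simp_all only: approx.simps)
    (meson approx_wqo wqo_qo wpo_iso_refl quasi_order_qsum quasi_order_qprod quasi_order_qpow
      quasi_order_qmsn quasi_order_qpf)+

lemma cover_qsum:
  assumes e: "elementary e1" "elementary e2" and S: "finite S" "S \<subseteq> fst (sem (ESum e1 e2))"
    and IH1: "\<And>S. finite S \<Longrightarrow> S \<subseteq> fst (sem e1) \<Longrightarrow> \<exists>Q f. approx e1 Q \<and> reflecting f (down (sem e1) S) (sem e1) Q"
    and IH2: "\<And>S. finite S \<Longrightarrow> S \<subseteq> fst (sem e2) \<Longrightarrow> \<exists>Q f. approx e2 Q \<and> reflecting f (down (sem e2) S) (sem e2) Q"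
  shows "\<exists>Q f. approx (ESum e1 e2) Q \<and> reflecting f (down (sem (ESum e1 e2)) S) (sem (ESum e1 e2)) Q"
proof -
  have fin: "finite (InL -` S)" "finite (InR -` S)"
    using S(1) by (auto intro!: finite_vimageI injI)
  have sub: "InL -` S \<subseteq> fst (sem e1)" "InR -` S \<subseteq> fst (sem e2)" using S(2) by auto
  obtain Q1 f1 where 1: "approx e1 Q1" "reflecting f1 (down (sem e1) (InL -` S)) (sem e1) Q1"
    using IH1[OF fin(1) sub(1)] by blast
  obtain Q2 f2 where 2: "approx e2 Q2" "reflecting f2 (down (sem e2) (InR -` S)) (sem e2) Q2"
    using IH2[OF fin(2) sub(2)] by blast
  define F where "F w = (case w of InL x \<Rightarrow> InL (f1 x) | InR x \<Rightarrow> InR (f2 x) | _ \<Rightarrow> w)" for w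
  have down: "down (sem (ESum e1 e2)) S = InL ` down (sem e1) (InL -` S) \<union> InR ` down (sem e2) (InR -` S)"
    (is "?A = ?B")
  proof
    have [simp]: "InL x \<in> InL ` A \<longleftrightarrow> x \<in> A" "InR x \<in> InR ` A \<longleftrightarrow> x \<in> A"
      "InL x \<notin> InR ` A" "InR x \<notin> InL ` A" for x and A :: "'a val set" by auto
    show "?A \<subseteq> ?B"
    proof
      fix w assume "w \<in> ?A"
      then obtain b where b: "w \<in> fst (sem (ESum e1 e2))" "b \<in> S" "snd (sem (ESum e1 e2)) w b"
        by (auto simp: down_def)
      moreover have "b \<in> fst (sem (ESum e1 e2))" using b(2) S(2) by blast
      ultimately show "w \<in> ?B" by (auto simp: down_def)
    qed
    show "?B \<subseteq> ?A" by (auto simp: down_def intro!: bexI)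
  qed
  have "reflecting F ?A (sem (ESum e1 e2)) (qsum Q1 Q2)"
    unfolding down
    by (intro reflectingI) (auto simp: F_def reflectingD[OF 1(2)] reflectingD[OF 2(2)])
  then show ?thesis using approx_construct(1)[OF e 1(1) 2(1)] by blast
qed

text \<open>The downset of \<open>S\<close> sits inside the rectangle formed by the downsets of the
  two projections of \<open>S\<close>.\<close>

lemma cover_qprod:
  assumes e: "elementary e1" "elementary e2" and S: "finite S" "S \<subseteq> fst (sem (EProd e1 e2))"
    and IH1: "\<And>S. finite S \<Longrightarrow> S \<subseteq> fst (sem e1) \<Longrightarrow> \<exists>Q f. approx e1 Q \<and> reflecting f (down (sem e1) S) (sem e1) Q"
    and IH2: "\<And>S. finite S \<Longrightarrow> S \<subseteq> fst (sem e2) \<Longrightarrow> \<exists>Q f. approx e2 Q \<and> reflecting f (down (sem e2) S) (sem e2) Q"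
  shows "\<exists>Q f. approx (EProd e1 e2) Q \<and> reflecting f (down (sem (EProd e1 e2)) S) (sem (EProd e1 e2)) Q"
proof -
  define S1 where "S1 = (\<lambda>w. case w of Pr a b \<Rightarrow> a | _ \<Rightarrow> w) ` S"
  define S2 where "S2 = (\<lambda>w. case w of Pr a b \<Rightarrow> b | _ \<Rightarrow> w) ` S"
  have fin: "finite S1" "finite S2" using S(1) by (auto simp: S1_def S2_def)
  have sub: "S1 \<subseteq> fst (sem e1)" "S2 \<subseteq> fst (sem e2)"
    using S(2) by (auto simp: S1_def S2_def fst_qprod dest!: subsetD[OF S(2)])
  obtain Q1 f1 where 1: "approx e1 Q1" "reflecting f1 (down (sem e1) S1) (sem e1) Q1"
    using IH1[OF fin(1) sub(1)] by blast
  obtain Q2 f2 where 2: "approx e2 Q2" "reflecting f2 (down (sem e2) S2) (sem e2) Q2"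
    using IH2[OF fin(2) sub(2)] by blast
  define F where "F w = (case w of Pr x y \<Rightarrow> Pr (f1 x) (f2 y) | _ \<Rightarrow> w)" for w
  have down: "\<exists>x y. w = Pr x y \<and> x \<in> down (sem e1) S1 \<and> y \<in> down (sem e2) S2"
    if wd: "w \<in> down (sem (EProd e1 e2)) S" for w
  proof -
    obtain x y b where w: "w = Pr x y" "x \<in> fst (sem e1)" "y \<in> fst (sem e2)" "b \<in> S"
      "snd (sem (EProd e1 e2)) w b"
      using wd by (auto simp: down_def fst_qprod)
    obtain c d where cd: "b = Pr c d" using subsetD[OF S(2) w(4)] by (auto simp: fst_qprod)
    then have "c \<in> S1" "d \<in> S2" using w(4) by (force simp: S1_def S2_def)+
    then show ?thesis using w cd by (auto simp: down_def)
  qed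
  have "reflecting F (down (sem (EProd e1 e2)) S) (sem (EProd e1 e2)) (qprod Q1 Q2)"
    by (intro reflectingI)
      (auto simp: F_def dest!: down[unfolded sem.simps] intro: reflectingD[OF 1(2)] reflectingD[OF 2(2)])
  then show ?thesis using approx_construct(2)[OF e 1(1) 2(1)] by blast
qed

text \<open>Words below \<open>S\<close> are no longer than the longest word of \<open>S\<close>, so
  padding to that length lands in one power. A componentwise comparison of padded words cannot have
  a longer left word: its first surplus letter would lie below the padding, which the shift
  excludes.\<close>

lemma cover_qstar:
  assumes e: "elementary e" and S: "finite S" "S \<subseteq> fst (sem (EStar e))"
    and IH: "\<And>S. finite S \<Longrightarrow> S \<subseteq> fst (sem e) \<Longrightarrow> \<exists>Q f. approx e Q \<and> reflecting f (down (sem e) S) (sem e) Q"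
  shows "\<exists>Q f. approx (EStar e) Q \<and> reflecting f (down (sem (EStar e)) S) (sem (EStar e)) Q"
proof -
  have qo: "quasi_order (sem e)" by (rule quasi_order_sem[OF e])
  obtain g z where g: "shift (sem e) g z" using shift_sem[OF e] by blast
  define wd where "wd w = (case w of Wd xs \<Rightarrow> xs | _ \<Rightarrow> [])" for w :: "'a val"
  define L where "L = (\<Union>w\<in>S. set (wd w))"
  \<comment> \<open>Inserting 0 keeps \<open>Max\<close> meaningful for empty
    \<open>S\<close>.\<close>
  define n where "n = Max (insert 0 ((\<lambda>w. length (wd w)) ` S))"
  have S_Wd: "w = Wd (wd w)" "set (wd w) \<subseteq> fst (sem e)" if "w \<in> S" for w
    using subsetD[OF S(2) that] by (auto simp: fst_qstar wd_def)
  have L: "finite L" "L \<subseteq> fst (sem e)" using S(1) S_Wd(2) by (auto simp: L_def)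
  \<comment> \<open>\<open>f\<close> reflects the order only on the covered downset, so the shifted
    letters and the padding letter must lie in it together.\<close>
  have "finite (insert z (g ` L))" "insert z (g ` L) \<subseteq> fst (sem e)"
    using L shiftD[OF g] by auto
  from IH[OF this] obtain Q f where Q: "approx e Q"
    and f: "reflecting f (down (sem e) (insert z (g ` L))) (sem e) Q" by blast
  define F where "F w = (case w of Wd xs \<Rightarrow>
    Wd (map (\<lambda>x. f (g x)) xs @ replicate (n - length xs) (f z)) | _ \<Rightarrow> w)" for w :: "'a val"
  have z: "z \<in> down (sem e) (insert z (g ` L))"
    using shiftD(1)[OF g] qo_refl[OF qo] by (auto simp: down_def)
  have down: "\<exists>xs. w = Wd xs \<and> length xs \<le> n \<and> set xs \<subseteq> fst (sem e) \<and>
      g ` set xs \<subseteq> down (sem e) (insert z (g ` L))"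
    if w: "w \<in> down (sem (EStar e)) S" for w
  proof -
    obtain xs b where xs: "w = Wd xs" "set xs \<subseteq> fst (sem e)" "b \<in> S" "snd (qstar (sem e)) (Wd xs) b"
      using w by (auto simp: down_def fst_qstar)
    then have emb: "list_emb (snd (sem e)) xs (wd b)" using S_Wd(1)[OF xs(3)] by (metis snd_qstar)
    have "length (wd b) \<le> n" using xs(3) S(1) unfolding n_def by (intro Max_ge) auto
    then have "length xs \<le> n" using list_emb_length[OF emb] by simp
    moreover have "g x \<in> down (sem e) (insert z (g ` L))" if x: "x \<in> set xs" for x
    proof -
      obtain y where y: "y \<in> set (wd b)" "snd (sem e) x y" using list_emb_set[OF emb x] by blast
      then have "y \<in> L" "y \<in> fst (sem e)" using xs(3) S_Wd(2)[OF xs(3)] by (auto simp: L_def)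
      moreover have "x \<in> fst (sem e)" using x xs(2) by blast
      ultimately show ?thesis
        using y(2) shiftD(2,4)[OF g] unfolding down_def by blast
    qed
    ultimately show ?thesis using xs(1,2) by blast
  qed
  have "reflecting F (down (sem (EStar e)) S) (sem (EStar e)) (qpow n Q)"
  proof (rule reflectingI)
    fix v assume "v \<in> down (sem (EStar e)) S"
    then obtain xs where xs: "v = Wd xs" "length xs \<le> n"
      "g ` set xs \<subseteq> down (sem e) (insert z (g ` L))" using down by blast
    then show "F v \<in> fst (qpow n Q)"
      using reflectingD(1)[OF f] z by (auto simp: F_def)
  next
    fix v w assume v: "v \<in> down (sem (EStar e)) S" and w: "w \<in> down (sem (EStar e)) S"
      and le: "snd (qpow n Q) (F v) (F w)"
    obtain xs where xs: "v = Wd xs" "length xs \<le> n" "set xs \<subseteq> fst (sem e)"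
      "g ` set xs \<subseteq> down (sem e) (insert z (g ` L))" using down[OF v] by blast
    obtain ys where ys: "w = Wd ys" "length ys \<le> n" "set ys \<subseteq> fst (sem e)"
      "g ` set ys \<subseteq> down (sem e) (insert z (g ` L))" using down[OF w] by blast
    have le_nth: "snd Q (f (g (xs ! i))) (if i < length ys then f (g (ys ! i)) else f z)"
      if "i < length xs" for i
      using le that xs(2) ys(2)
      by (auto simp: xs(1) ys(1) F_def list_all2_conv_all_nth nth_append dest!: spec[of _ i])
    have len: "length xs \<le> length ys"
    proof (rule ccontr)
      assume "\<not> length xs \<le> length ys"
      then have i: "length ys < length xs" by simp
      then have "xs ! length ys \<in> set xs" by simp
      moreover have "snd Q (f (g (xs ! length ys))) (f z)" using le_nth[OF i] by simp
      ultimately have "snd (sem e) (g (xs ! length ys)) z"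
        using reflectingD(2)[OF f] xs(4) z by blast
      then show False using shiftD(3)[OF g] xs(3) \<open>xs ! length ys \<in> set xs\<close> by blast
    qed
    have "snd (sem e) (xs ! i) (ys ! i)" if i: "i < length xs" for i
    proof -
      have mem: "xs ! i \<in> set xs" "ys ! i \<in> set ys" using i len by auto
      have "snd Q (f (g (xs ! i))) (f (g (ys ! i)))" using le_nth[OF i] i len by simp
      then have "snd (sem e) (g (xs ! i)) (g (ys ! i))"
        using reflectingD(2)[OF f] xs(4) ys(4) mem by blast
      then show ?thesis using shiftD(4)[OF g] xs(3) ys(3) mem by blast
    qed
    then have "list_all2 (snd (sem e)) xs (take (length xs) ys)"
      using len by (auto simp: list_all2_conv_all_nth)
    then have "list_emb (snd (sem e)) xs (take (length xs) ys)"
      using len by (simp add: list_emb_same_length_iff)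
    then have "list_emb (snd (sem e)) xs (take (length xs) ys @ drop (length xs) ys)" by blast
    then show "snd (sem (EStar e)) v w" by (simp add: xs(1) ys(1))
  qed
  then show ?thesis using approx_construct(3)[OF e Q] by blast
qed

lemma mset_emb_size: "mset_emb le A B \<Longrightarrow> size A \<le> size B"
  by (auto simp: mset_emb_iff_rel_mset dest!: rel_mset_size size_mset_mono)

lemma mset_emb_set:
  assumes "mset_emb le A B" "x \<in># A"
  shows "\<exists>y\<in>#B. le x y"
proof -
  obtain N where N: "N \<subseteq># B" "rel_mset le A N" using assms(1) by (auto simp: mset_emb_iff_rel_mset)
  obtain A' where "A = add_mset x A'" using assms(2) by (metis insert_DiffM)
  then obtain y N' where "N = add_mset y N'" "le x y" using N(2) msed_rel_invL by metis
  then show ?thesis using N(1) by (metis mset_subset_eqD union_single_eq_member)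
qed

text \<open>As for words, with size in place of length; since letters have no positions, the padding
  is removed by cancelling it from the matching.\<close>

lemma cover_qms:
  assumes e: "elementary e" and S: "finite S" "S \<subseteq> fst (sem (EMs e))"
    and IH: "\<And>S. finite S \<Longrightarrow> S \<subseteq> fst (sem e) \<Longrightarrow> \<exists>Q f. approx e Q \<and> reflecting f (down (sem e) S) (sem e) Q"
  shows "\<exists>Q f. approx (EMs e) Q \<and> reflecting f (down (sem (EMs e)) S) (sem (EMs e)) Q"
proof -
  have qo: "quasi_order (sem e)" by (rule quasi_order_sem[OF e])
  obtain g z where g: "shift (sem e) g z" using shift_sem[OF e] by blast
  define ms where "ms w = (case w of MS m \<Rightarrow> m | _ \<Rightarrow> {#})" for w :: "'a val"
  define L where "L = (\<Union>w\<in>S. set_mset (ms w))"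
  define n where "n = Max (insert 0 ((\<lambda>w. size (ms w)) ` S))"
  have S_MS: "w = MS (ms w)" "set_mset (ms w) \<subseteq> fst (sem e)" if "w \<in> S" for w
    using subsetD[OF S(2) that] by (auto simp: fst_qms ms_def)
  have L: "finite L" "L \<subseteq> fst (sem e)" using S(1) S_MS(2) by (auto simp: L_def)
  have "finite (insert z (g ` L))" "insert z (g ` L) \<subseteq> fst (sem e)"
    using L shiftD[OF g] by auto
  from IH[OF this] obtain Q f where Q: "approx e Q"
    and f: "reflecting f (down (sem e) (insert z (g ` L))) (sem e) Q" by blast
  define F where "F w = (case w of MS m \<Rightarrow>
    MS (image_mset (\<lambda>x. f (g x)) m + replicate_mset (n - size m) (f z)) | _ \<Rightarrow> w)" for w :: "'a val"
  have z: "z \<in> down (sem e) (insert z (g ` L))"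
    using shiftD(1)[OF g] qo_refl[OF qo] by (auto simp: down_def)
  have down: "\<exists>m. w = MS m \<and> size m \<le> n \<and> set_mset m \<subseteq> fst (sem e) \<and>
      g ` set_mset m \<subseteq> down (sem e) (insert z (g ` L))"
    if w: "w \<in> down (sem (EMs e)) S" for w
  proof -
    obtain m b where m: "w = MS m" "set_mset m \<subseteq> fst (sem e)" "b \<in> S" "snd (qms (sem e)) (MS m) b"
      using w by (auto simp: down_def fst_qms)
    then have emb: "mset_emb (snd (sem e)) m (ms b)" using S_MS(1)[OF m(3)] by (metis snd_qms)
    have "size (ms b) \<le> n" using m(3) S(1) unfolding n_def by (intro Max_ge) auto
    then have "size m \<le> n" using mset_emb_size[OF emb] by simp
    moreover have "g x \<in> down (sem e) (insert z (g ` L))" if x: "x \<in># m" for x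
    proof -
      obtain y where y: "y \<in># ms b" "snd (sem e) x y" using mset_emb_set[OF emb x] by blast
      then have "y \<in> L" "y \<in> fst (sem e)" using m(3) S_MS(2)[OF m(3)] by (auto simp: L_def)
      moreover have "x \<in> fst (sem e)" using x m(2) by blast
      ultimately show ?thesis
        using y(2) shiftD(2,4)[OF g] unfolding down_def by blast
    qed
    ultimately show ?thesis using m(1,2) by blast
  qed
  have "reflecting F (down (sem (EMs e)) S) (sem (EMs e)) (qmsn n Q)"
  proof (rule reflectingI)
    fix v assume "v \<in> down (sem (EMs e)) S"
    then obtain m where m: "v = MS m" "size m \<le> n"
      "g ` set_mset m \<subseteq> down (sem e) (insert z (g ` L))" using down by blast
    then show "F v \<in> fst (qmsn n Q)"
      using reflectingD(1)[OF f] z by (auto simp: F_def)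
  next
    fix v w assume v: "v \<in> down (sem (EMs e)) S" and w: "w \<in> down (sem (EMs e)) S"
      and le: "snd (qmsn n Q) (F v) (F w)"
    obtain m where m: "v = MS m" "size m \<le> n" "set_mset m \<subseteq> fst (sem e)"
      "g ` set_mset m \<subseteq> down (sem e) (insert z (g ` L))" using down[OF v] by blast
    obtain m' where m': "w = MS m'" "size m' \<le> n" "set_mset m' \<subseteq> fst (sem e)"
      "g ` set_mset m' \<subseteq> down (sem e) (insert z (g ` L))" using down[OF w] by blast
    have "mset_emb (snd Q) (image_mset (\<lambda>x. f (g x)) m + replicate_mset (n - size m) (f z))
      (image_mset (\<lambda>x. f (g x)) m' + replicate_mset (n - size m') (f z))"
      using le by (simp add: F_def m(1) m'(1))
    then have "mset_emb (\<lambda>x y. snd Q (f (g x)) (f (g y))) m m'"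
    proof (rule mset_emb_cancel_padding)
      fix x assume x: "x \<in># m"
      show "\<not> snd Q (f (g x)) (f z)"
        using x m(3,4) shiftD(3)[OF g] reflectingD(2)[OF f _ z] by blast
    qed
    then have "mset_emb (snd (sem e)) m m'"
    proof (rule mset_emb_mono)
      fix x y assume xy: "x \<in># m" "y \<in># m'" "snd Q (f (g x)) (f (g y))"
      then have "snd (sem e) (g x) (g y)" using reflectingD(2)[OF f] m(4) m'(4) by blast
      then show "snd (sem e) x y" using shiftD(4)[OF g] xy m(3) m'(3) by blast
    qed
    then show "snd (sem (EMs e)) v w" by (simp add: m(1) m'(1))
  qed
  then show ?thesis using approx_construct(4)[OF e Q] by blast
qed

text \<open>The Hoare order compares elements one at a time, so \<open>f\<close> acts elementwise;
  the union of the members of \<open>S\<close> generates a downset containing every set below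
  \<open>S\<close>.\<close>

lemma cover_qpf:
  assumes e: "elementary e" and S: "finite S" "S \<subseteq> fst (sem (EPf e))"
    and IH: "\<And>S. finite S \<Longrightarrow> S \<subseteq> fst (sem e) \<Longrightarrow> \<exists>Q f. approx e Q \<and> reflecting f (down (sem e) S) (sem e) Q"
  shows "\<exists>Q f. approx (EPf e) Q \<and> reflecting f (down (sem (EPf e)) S) (sem (EPf e)) Q"
proof -
  define fs where "fs w = (case w of FS s \<Rightarrow> fset s | _ \<Rightarrow> {})" for w :: "'a val"
  define L where "L = (\<Union>w\<in>S. fs w)"
  have S_FS: "\<exists>s. w = FS s \<and> fset s \<subseteq> fst (sem e)" if "w \<in> S" for w
    using subsetD[OF S(2) that] by (auto simp: fst_qpf)
  have "finite (fs w)" "fs w \<subseteq> fst (sem e)" if "w \<in> S" for w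
    using S_FS[OF that] by (auto simp: fs_def)
  then have L: "finite L" "L \<subseteq> fst (sem e)" using S(1) by (auto simp: L_def)
  from IH[OF this] obtain Q f where Q: "approx e Q"
    and f: "reflecting f (down (sem e) L) (sem e) Q" by blast
  define F where "F w = (case w of FS s \<Rightarrow> FS (f |`| s) | _ \<Rightarrow> w)" for w :: "'a val"
  have down: "\<exists>s. w = FS s \<and> fset s \<subseteq> down (sem e) L"
    if w: "w \<in> down (sem (EPf e)) S" for w
  proof -
    obtain s b where s: "w = FS s" "fset s \<subseteq> fst (sem e)" "b \<in> S" "snd (qpf (sem e)) (FS s) b"
      using w by (auto simp: down_def fst_qpf)
    obtain t where t: "b = FS t" using S_FS[OF s(3)] by blast
    then have "fset t \<subseteq> L" using s(3) by (force simp: L_def fs_def)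
    then show ?thesis using s t by (fastforce simp: down_def)
  qed
  have "reflecting F (down (sem (EPf e)) S) (sem (EPf e)) (qpf Q)"
  proof (rule reflectingI)
    fix v assume "v \<in> down (sem (EPf e)) S"
    then obtain s where s: "v = FS s" "fset s \<subseteq> down (sem e) L" using down by blast
    then show "F v \<in> fst (qpf Q)" using reflectingD(1)[OF f] by (auto simp: F_def)
  next
    fix v w assume v: "v \<in> down (sem (EPf e)) S" and w: "w \<in> down (sem (EPf e)) S"
      and le: "snd (qpf Q) (F v) (F w)"
    obtain s where s: "v = FS s" "fset s \<subseteq> down (sem e) L" using down[OF v] by blast
    obtain t where t: "w = FS t" "fset t \<subseteq> down (sem e) L" using down[OF w] by blast
    have "\<exists>b\<in>fset t. snd (sem e) a b" if a: "a \<in> fset s" for a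
    proof -
      obtain b where "b \<in> fset t" "snd Q (f a) (f b)" using le a by (auto simp: F_def s(1) t(1))
      then show ?thesis using reflectingD(2)[OF f] s(2) t(2) a by blast
    qed
    then show "snd (sem (EPf e)) v w" by (simp add: s(1) t(1))
  qed
  then show ?thesis using approx_construct(5)[OF e Q] by blast
qed

lemma approx_cover:
  "elementary e \<Longrightarrow> finite S \<Longrightarrow> S \<subseteq> fst (sem e) \<Longrightarrow>
    \<exists>Q f. approx e Q \<and> reflecting f (down (sem e) S) (sem e) Q"
proof (induction e arbitrary: S)
  case (EOrd r)
  then show ?case unfolding sem.simps by (intro cover_qord) auto
next
  case (ESum e1 e2)
  then show ?case by (intro cover_qsum) auto
next
  case (EProd e1 e2)
  then show ?case by (intro cover_qprod) auto
next
  case (EStar e)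
  then show ?case by (intro cover_qstar) auto
next
  case (EMs e)
  then show ?case by (intro cover_qms) auto
next
  case (EPf e)
  then show ?case by (intro cover_qpf) auto
qed


section \<open>Comparison of the trees\<close>

text \<open>\<open>rank_le\<close> is inductive, so a simulation proves it only if the recursion
  terminates. Each step descends in both trees at once, hence accessibility of either starting node
  is enough.\<close>

lemma rank_le_simulation:
  assumes acc: "Wellfounded.accp R x \<or> Wellfounded.accp S y" and "rel x y"
    and sim: "\<And>x y x'. rel x y \<Longrightarrow> R x' x \<Longrightarrow> \<exists>y'. S y' y \<and> rel x' y'"
  shows "rank_le R S x y"
  using acc
proof
  assume "Wellfounded.accp R x"
  then show ?thesis using \<open>rel x y\<close>
  proof (induction arbitrary: y rule: accp.induct)
    case (accI x)
    then show ?case using sim by (intro rank_le.intros) meson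
  qed
next
  assume "Wellfounded.accp S y"
  then show ?thesis using \<open>rel x y\<close>
  proof (induction arbitrary: x rule: accp.induct)
    case (accI y)
    then show ?case using sim by (intro rank_le.intros) meson
  qed
qed

lemma wf_bad_seq:
  assumes wqo: "wqo Q"
  shows "wfp (seq_child (bad_seq Q))"
  unfolding wfp_def wf_iff_no_infinite_down_chain
proof
  assume "\<exists>f. \<forall>i. (f (Suc i), f i) \<in> {(x, y). seq_child (bad_seq Q) x y}"
  then obtain f where f: "\<And>i. seq_child (bad_seq Q) (f (Suc i)) (f i)" by blast
  then have "\<forall>i. \<exists>x. f (Suc i) = f i @ [x]" and bad: "\<And>i. bad_seq Q (f (Suc i))"
    by (auto simp: seq_child_def)
  then obtain x where x: "\<And>i. f (Suc i) = f i @ [x i]" by metis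
  have f_eq: "f n = f 0 @ map x [0..<n]" for n by (induction n) (simp_all add: x)
  have "x i \<in> fst Q" for i using bad[of i] by (auto simp: x bad_seq_def)
  moreover have "\<not> snd Q (x i) (x j)" if "i < j" for i j
  proof -
    \<comment> \<open>The branch may begin at a nonempty sequence, so the added elements sit at
      positions shifted by its length.\<close>
    let ?k = "length (f 0)"
    have "f (Suc j) ! (?k + i) = x i" "f (Suc j) ! (?k + j) = x j" "length (f (Suc j)) = ?k + Suc j"
      using that by (simp_all add: f_eq[of "Suc j"] nth_append del: upt_Suc)
    then show ?thesis using bad[of j] that unfolding bad_seq_def
      by (metis add_strict_left_mono lessI)
  qed
  ultimately show False using wqoD[OF wqo, of x] by blast
qed

text \<open>Below a chosen approximation \<open>Q\<close> the tree is that of the bad sequences of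
  \<open>Q\<close>, which keeps both simulations terminating.\<close>

lemma accp_osup_child:
  assumes wqo: "wqo Q"
  shows "Wellfounded.accp (osup_child e) (Some (Q, xs))"
  using wf_bad_seq[OF wqo]
proof (induction xs rule: wfp_induct_rule)
  case (less xs)
  show ?case
  proof (rule accp.accI)
    fix t assume "osup_child e t (Some (Q, xs))"
    then obtain ys where "t = Some (Q, ys)" "seq_child (bad_seq Q) ys xs"
      by (cases t) (auto simp: osup_child_def)
    then show "Wellfounded.accp (osup_child e) t" using less by blast
  qed
qed

lemma bad_seq_snocI:
  assumes "bad_seq Q xs" "x \<in> fst Q" "\<And>y. y \<in> set xs \<Longrightarrow> \<not> snd Q y x"
  shows "bad_seq Q (xs @ [x])"
  using assms unfolding bad_seq_def by (auto simp: nth_append less_Suc_eq)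

text \<open>From a decreasing sequence below \<open>s\<close>, choose at each step an element of the old set that is not
  dominated by the new one; these elements form a bad sequence in the downset of \<open>s\<close>.\<close>
lemma rank_decr_le_bad:
  assumes qo: "quasi_order E" and s: "fset s \<subseteq> fst E"
    and wqo: "wqo Q" and f: "reflecting f (down E (fset s)) E Q"
  shows "rank_le (seq_child (decr_seq (qpf E))) (osup_child e) [FS s] (Some (Q, []))"
proof -
  \<comment> \<open>The chosen elements stay outside the downset of the current last set
    \<open>t\<close>, so an element of \<open>t\<close> chosen next is above none of them. They are
    recorded before applying \<open>f\<close>, in the form needed for reflection.\<close>
  define rel where "rel = (\<lambda>ss y. \<exists>ts t xs. decr_seq (qpf E) ss \<and> ss = ts @ [FS t] \<and> hd ss = FS s \<and>
    y = Some (Q, map f xs) \<and> bad_seq Q (map f xs) \<and> set xs \<subseteq> down E (fset s) - down E (fset t))"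
  show ?thesis
  proof (rule rank_le_simulation[where rel = rel])
    show "Wellfounded.accp (seq_child (decr_seq (qpf E))) [FS s] \<or>
      Wellfounded.accp (osup_child e) (Some (Q, []))"
      using accp_osup_child[OF wqo] by blast
    show "rel [FS s] (Some (Q, []))"
      using s unfolding rel_def
      by (intro exI[of _ "[]"] exI[of _ s]) (auto simp: decr_seq_def bad_seq_def)
    fix ss y ss' assume "rel ss y" and ch: "seq_child (decr_seq (qpf E)) ss' ss"
    then obtain ts t xs where ss: "decr_seq (qpf E) ss" "ss = ts @ [FS t]" "hd ss = FS s"
      and y: "y = Some (Q, map f xs)" and bad: "bad_seq Q (map f xs)"
      and xs: "set xs \<subseteq> down E (fset s) - down E (fset t)"
      unfolding rel_def by blast
    obtain w where w: "ss' = ss @ [w]" "decr_seq (qpf E) ss'" using ch by (auto simp: seq_child_def)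
    then obtain u where u: "w = FS u" by (auto simp: decr_seq_def fst_qpf)
    have nth: "ss' ! length ts = FS t" "ss' ! Suc (length ts) = FS u" "length ss' = Suc (Suc (length ts))"
      "ss' ! 0 = FS s"
      using ss(2,3) w(1) u by (auto simp: nth_append hd_conv_nth)
    have sub: "fset t \<subseteq> fst E" "fset u \<subseteq> fst E"
      using w(2) nth by (auto simp: decr_seq_def subset_iff w(1) ss(2) u)
    have "snd (qpf E) (FS u) (FS t)" "\<not> snd (qpf E) (FS t) (FS u)"
      using w(2) nth unfolding decr_seq_def by (metis lessI)+
    then obtain x where x: "x \<in> fset t" "x \<notin> down E (fset u)"
      and ut: "\<And>a. a \<in> fset u \<Longrightarrow> \<exists>b\<in>fset t. snd E a b"
      using sub by (auto simp: down_def subset_iff)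
    \<comment> \<open>For empty \<open>ts\<close> the last set is \<open>s\<close> itself and
      reflexivity applies; otherwise this is part of strict decrease.\<close>
    have ts: "\<And>a. a \<in> fset t \<Longrightarrow> \<exists>b\<in>fset s. snd E a b"
    proof (cases ts)
      case Nil
      then show "\<And>a. a \<in> fset t \<Longrightarrow> \<exists>b\<in>fset s. snd E a b"
        using ss(2,3) qo_refl[OF qo] sub(1) by auto
    next
      case (Cons v vs)
      then have "0 < length ts" by simp
      then have "snd (qpf E) (FS t) (FS s)"
        using w(2) nth unfolding decr_seq_def by (metis lessI less_SucI)
      then show "\<And>a. a \<in> fset t \<Longrightarrow> \<exists>b\<in>fset s. snd E a b" by simp
    qed
    have xE: "x \<in> fst E" using x(1) sub(1) by blast
    have xs_x: "x \<in> down E (fset s)" using ts[OF x(1)] xE by (auto simp: down_def)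
    have down_ut: "down E (fset u) \<subseteq> down E (fset t)"
    proof
      fix a assume "a \<in> down E (fset u)"
      then obtain b where b: "a \<in> fst E" "b \<in> fset u" "snd E a b" by (auto simp: down_def)
      obtain c where "c \<in> fset t" "snd E b c" using ut[OF b(2)] by blast
      moreover from this have "snd E a c" using qo_trans[OF qo b(3)] b(1,2) sub by blast
      ultimately show "a \<in> down E (fset t)" using b(1) by (auto simp: down_def)
    qed
    have "\<not> snd Q (f a) (f x)" if a: "a \<in> set xs" for a
    proof
      assume "snd Q (f a) (f x)"
      then have "snd E a x" using reflectingD(2)[OF f] a xs xs_x by blast
      then show False using a xs x(1) by (auto simp: down_def)
    qed
    then have bad': "bad_seq Q (map f xs @ [f x])"
      by (intro bad_seq_snocI bad) (use reflectingD(1)[OF f xs_x] in auto)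
    have "rel ss' (Some (Q, map f xs @ [f x]))"
      unfolding rel_def
      by (intro exI[of _ ss] exI[of _ u] exI[of _ "xs @ [x]"])
        (use w u ss(2,3) bad' xs xs_x x(2) down_ut in \<open>auto simp: hd_append\<close>)
    moreover have "osup_child e (Some (Q, map f xs @ [f x])) y"
      using bad' by (simp add: y osup_child_def seq_child_def)
    ultimately show "\<exists>y'. osup_child e y' y \<and> rel ss' y'" by blast
  qed
qed

text \<open>A bad sequence \<open>x\<^sub>1, x\<^sub>2, \<dots>\<close> shrinks the downset of elements that are above no \<open>x\<^sub>i\<close> seen so far.\<close>
lemma rank_bad_le_decr:
  assumes wqo: "wqo Q" and emb: "ideal_emb Q P"
  shows "\<exists>w. decr_seq (qpf P) [w] \<and>
    rank_le (osup_child e) (seq_child (decr_seq (qpf P))) (Some (Q, [])) [w]"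
proof -
  note qo = wqo_qo[OF wqo]
  obtain \<psi> where \<psi>: "\<forall>D. downset Q D \<longrightarrow> \<psi> D \<in> fst (qpf P)"
    "\<forall>D E. downset Q D \<longrightarrow> downset Q E \<longrightarrow> (snd (qpf P) (\<psi> D) (\<psi> E) \<longleftrightarrow> D \<subseteq> E)"
    using downset_emb[OF assms] by (elim exE conjE)
  define D where "D xs = {y \<in> fst Q. \<forall>x\<in>set xs. \<not> snd Q x y}" for xs
  have D: "downset Q (D xs)" if "set xs \<subseteq> fst Q" for xs
    unfolding downset_def D_def using that by (auto dest: qo_trans[OF qo])
  \<comment> \<open>Every prefix contributes a set, the empty one included: a bad sequence of length
    \<open>k\<close> is coded by \<open>k + 1\<close> sets, the first coding all of
    \<open>Q\<close>.\<close>
  define c where "c xs = map (\<lambda>k. \<psi> (D (take k xs))) [0..<Suc (length xs)]" for xs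
  have c_decr: "decr_seq (qpf P) (c xs)" if bad: "bad_seq Q xs" for xs
    unfolding decr_seq_def
  proof (intro conjI allI impI)
    have xs: "set xs \<subseteq> fst Q" using bad by (simp add: bad_seq_def)
    have Dk: "downset Q (D (take k xs))" for k using D xs set_take_subset by (metis subset_trans)
    show "set (c xs) \<subseteq> fst (qpf P)" using \<psi>(1) Dk by (auto simp: c_def simp del: upt_Suc)
    fix i j assume ij: "i < j \<and> j < length (c xs)"
    then have len: "i < length xs" "j \<le> length xs" by (auto simp: c_def)
    have nth: "c xs ! i = \<psi> (D (take i xs))" "c xs ! j = \<psi> (D (take j xs))"
      using ij by (simp_all add: c_def del: upt_Suc)
    have "D (take j xs) \<subseteq> D (take i xs)"
      using ij set_take_subset_set_take[of i j xs] by (auto simp: D_def)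
    then show "snd (qpf P) (c xs ! j) (c xs ! i)" using \<psi>(2) Dk nth by simp
    have x: "xs ! i \<in> fst Q" using xs len(1) by auto
    \<comment> \<open>\<open>xs ! i\<close> witnesses strictness: badness keeps it in the downset
      for the first \<open>i\<close> elements, and reflexivity removes it once it has been listed
      itself.\<close>
    have "xs ! i \<in> D (take i xs)"
      using bad len(1) x by (auto simp: D_def bad_seq_def in_set_conv_nth)
    moreover have "xs ! i \<in> set (take j xs)"
      using ij len by (auto simp: in_set_conv_nth)
    then have "xs ! i \<notin> D (take j xs)" using qo_refl[OF qo x] by (auto simp: D_def)
    ultimately show "\<not> snd (qpf P) (c xs ! i) (c xs ! j)" using \<psi>(2) Dk nth by auto
  qed
  define rel where "rel = (\<lambda>y ss. \<exists>xs. y = Some (Q, xs) \<and> bad_seq Q xs \<and> ss = c xs)"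
  have nil: "bad_seq Q []" by (simp add: bad_seq_def)
  have "rank_le (osup_child e) (seq_child (decr_seq (qpf P))) (Some (Q, [])) (c [])"
  proof (rule rank_le_simulation[where rel = rel])
    show "Wellfounded.accp (osup_child e) (Some (Q, [])) \<or>
      Wellfounded.accp (seq_child (decr_seq (qpf P))) (c [])"
      using accp_osup_child[OF wqo] by blast
    show "rel (Some (Q, [])) (c [])" using nil by (simp add: rel_def)
    fix y ss y' assume "rel y ss" "osup_child e y' y"
    then obtain xs xs' where xs: "y = Some (Q, xs)" "ss = c xs" "y' = Some (Q, xs')"
      "seq_child (bad_seq Q) xs' xs"
      by (cases y') (auto simp: rel_def osup_child_def)
    then obtain x where x: "xs' = xs @ [x]" "bad_seq Q xs'" by (auto simp: seq_child_def)
    have "c xs' = c xs @ [\<psi> (D xs')]" by (simp add: c_def x(1))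
    then have "seq_child (decr_seq (qpf P)) (c xs') ss"
      using c_decr[OF x(2)] by (simp add: seq_child_def xs(2))
    then show "\<exists>ss'. seq_child (decr_seq (qpf P)) ss' ss \<and> rel y' ss'"
      using x(2) xs(3) by (auto simp: rel_def)
  qed
  then show ?thesis using c_decr[OF nil] by (simp add: c_def) blast
qed

theorem mainTheorem14:
  fixes e :: "'a expr"
  assumes "elementary e" and "normal_form e"
  shows "rank_eq (seq_child (decr_seq (qpf (sem e)))) [] (osup_child e) None"
  unfolding rank_eq_def
proof
  note el = assms(1)
  show "rank_le (seq_child (decr_seq (qpf (sem e)))) (osup_child e) [] None"
  proof (intro rank_le.intros allI impI)
    fix ss assume "seq_child (decr_seq (qpf (sem e))) ss []"
    then obtain s where s: "ss = [FS s]" "fset s \<subseteq> fst (sem e)"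
      by (auto simp: seq_child_def decr_seq_def fst_qpf)
    \<comment> \<open>The first set bounds all later ones, so it determines one approximation for
      the entire subtree.\<close>
    obtain Q f where Q: "approx e Q" "reflecting f (down (sem e) (fset s)) (sem e) Q"
      using approx_cover[OF el _ s(2)] by auto
    have "osup_child e (Some (Q, [])) None" using Q(1) by (simp add: osup_child_def)
    moreover have "rank_le (seq_child (decr_seq (qpf (sem e)))) (osup_child e) ss (Some (Q, []))"
      unfolding s(1)
      by (rule rank_decr_le_bad[OF quasi_order_sem[OF el] s(2) approx_wqo[OF el Q(1)] Q(2)])
    ultimately show "\<exists>y. osup_child e y None \<and>
      rank_le (seq_child (decr_seq (qpf (sem e)))) (osup_child e) ss y" by blast
  qed
  show "rank_le (osup_child e) (seq_child (decr_seq (qpf (sem e)))) None []"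
  proof (intro rank_le.intros allI impI)
    fix y assume "osup_child e y None"
    then obtain Q where Q: "y = Some (Q, [])" "approx e Q"
      by (cases y) (auto simp: osup_child_def)
    \<comment> \<open>The choice of \<open>Q\<close> at the root is answered by a single set, the
      code of the full downset of \<open>Q\<close>; this accounts for the extra level in both
      trees.\<close>
    obtain w where "decr_seq (qpf (sem e)) [w]"
      "rank_le (osup_child e) (seq_child (decr_seq (qpf (sem e)))) (Some (Q, [])) [w]"
      using rank_bad_le_decr[OF approx_wqo[OF el Q(2)] approx_ideal_emb[OF el Q(2)]] by blast
    then show "\<exists>ss. seq_child (decr_seq (qpf (sem e))) ss [] \<and>
      rank_le (osup_child e) (seq_child (decr_seq (qpf (sem e)))) y ss"
      using Q(1) by (auto simp: seq_child_def)
  qed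
qed

end
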